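(* Let $\Gamma$ be a discrete abelian group and $A, B\subseteq \Gamma$ nonempty. There is a unique finite index subgroup $K\leq \Gamma$ (depending only on $A+B$) satisfying all of the following: if $\nu$ is an extreme invariant mean on $\ell^\infty(\Gamma)$ and $\nu(A+B)<\nu(A)+\nu(B)$, then $\nu(A+B)=\nu(A+B+K)$ and \[\nu(A+B+K)=\nu(A+K)+\nu(B+K)-\nu(K),\] and $K$ is the stabilizer of $A+B+K$.
   Context: $A+B:=\{a+b:a\in A,b\in B\}$. A mean on $\ell^\infty(\Gamma)$ is a linear functional $m:\ell^\infty(\Gamma)\to\mathbb C$ with $m(1_\Gamma)=1$ and $m(f)\ge 0$ for $f:\Gamma\to[0,1]$; write $m(C):=m(1_C)$. It is invariant if $m(\tau_\gamma f)=m(f)$ for all $f\in\ell^\infty(\Gamma)$, $\gamma\in\Gamma$, where $(\tau_\gamma f)(x)=f(x-\gamma)$. The set $\mathcal M_\tau(\Gamma)$ of invariant means is a weak$^*$-compact convex subset of $\ell^\infty(\Gamma)^*$; an extreme invariant mean is an extreme point of this set. The stabilizer of $C\subseteq\Gamma$ is the subgroup $H(C):=\{\gamma\in\Gamma: C+\gamma=C\}$.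
   Formalization: Uniqueness of K is asserted only when some extreme invariant mean ν satisfies ν(A+B)<ν(A)+ν(B); without such a ν it can fail: for A=B={0} in the integers every nonzero subgroup K qualifies. *)

theory Defs
  imports "HOL-Analysis.Analysis" "HOL-Library.Set_Algebras"
begin

text \<open>
  A discrete abelian group is a type of class \<open>{ab_group_add, discrete_topology}\<close>. Every map on
  it is continuous, so \<open>'a \<Rightarrow>\<^sub>C complex\<close> is the space of all bounded functions with the sup norm.
\<close>

definition bscale :: "complex \<Rightarrow> ('a::topological_space \<Rightarrow>\<^sub>C complex) \<Rightarrow> ('a \<Rightarrow>\<^sub>C complex)" where
  "bscale c f = Bcontfun (\<lambda>x. c * apply_bcontfun f x)"

definition char_fun :: "'a::discrete_topology set \<Rightarrow> ('a \<Rightarrow>\<^sub>C complex)" where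
  "char_fun C = Bcontfun (\<lambda>x. if x \<in> C then 1 else 0)"

definition translate ::
  "'a::{ab_group_add, discrete_topology} \<Rightarrow> ('a \<Rightarrow>\<^sub>C complex) \<Rightarrow> ('a \<Rightarrow>\<^sub>C complex)" where
  "translate \<gamma> f = Bcontfun (\<lambda>x. apply_bcontfun f (x - \<gamma>))"

text \<open>\<open>Bcontfun\<close> is unspecified outside \<open>bcontfun\<close>; here its argument always lies in \<open>bcontfun\<close>.\<close>

lemma apply_bscale [simp]: "apply_bcontfun (bscale c f) x = c * apply_bcontfun f x"
proof -
  have "(\<lambda>x. c * apply_bcontfun f x) \<in> bcontfun"
    by (rule bcontfun_normI[where b = "norm c * norm f"])
       (auto intro!: continuous_intros mult_left_mono norm_bounded simp: norm_mult)
  then show ?thesis by (simp add: bscale_def Bcontfun_inverse)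
qed

lemma apply_char_fun [simp]: "apply_bcontfun (char_fun C) x = (if x \<in> C then 1 else 0)"
proof -
  have "(\<lambda>x. if x \<in> C then 1 else 0 :: complex) \<in> bcontfun"
    by (rule bcontfun_normI[where b = 1]) auto
  then show ?thesis by (simp add: char_fun_def Bcontfun_inverse)
qed

lemma apply_translate [simp]: "apply_bcontfun (translate \<gamma> f) x = apply_bcontfun f (x - \<gamma>)"
proof -
  have "(\<lambda>x. apply_bcontfun f (x - \<gamma>)) \<in> bcontfun"
    by (rule bcontfun_normI[where b = "norm f"]) (auto simp: norm_bounded)
  then show ?thesis by (simp add: translate_def Bcontfun_inverse)
qed

text \<open>
  The elements of \<open>('a \<Rightarrow>\<^sub>C complex) \<Rightarrow>\<^sub>L complex\<close> are only real-linear, so homogeneity over the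
  complex numbers is required separately. Boundedness is no restriction: a linear functional that
  is nonnegative on functions with values in the unit interval is bounded.
\<close>

definition is_mean :: "(('a::discrete_topology \<Rightarrow>\<^sub>C complex) \<Rightarrow>\<^sub>L complex) \<Rightarrow> bool" where
  "is_mean m \<longleftrightarrow>
     (\<forall>c f. blinfun_apply m (bscale c f) = c * blinfun_apply m f) \<and>
     blinfun_apply m (char_fun UNIV) = 1 \<and>
     (\<forall>f. (\<forall>x. apply_bcontfun f x \<in> complex_of_real ` {0..1}) \<longrightarrow>
        blinfun_apply m f \<in> complex_of_real ` {0..})"

definition invariant_means ::
  "(('a::{ab_group_add, discrete_topology} \<Rightarrow>\<^sub>C complex) \<Rightarrow>\<^sub>L complex) set" where
  "invariant_means =
     {m. is_mean m \<and> (\<forall>\<gamma> f. blinfun_apply m (translate \<gamma> f) = blinfun_apply m f)}"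

text \<open>For a mean the value at a characteristic function is real, so \<open>Re\<close> loses nothing.\<close>

definition mean_of :: "(('a::discrete_topology \<Rightarrow>\<^sub>C complex) \<Rightarrow>\<^sub>L complex) \<Rightarrow> 'a set \<Rightarrow> real" where
  "mean_of m C = Re (blinfun_apply m (char_fun C))"

definition finite_index_subgroup :: "'a::ab_group_add set \<Rightarrow> bool" where
  "finite_index_subgroup K \<longleftrightarrow>
     0 \<in> K \<and> (\<forall>x\<in>K. \<forall>y\<in>K. x + y \<in> K) \<and> (\<forall>x\<in>K. - x \<in> K) \<and>
     finite (range (\<lambda>\<gamma>. {\<gamma>} + K))"

definition stabilizer :: "'a::ab_group_add set \<Rightarrow> 'a set" where
  "stabilizer C = {\<gamma>. C + {\<gamma>} = C}"

definition small_sumset ::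
  "(('a::{ab_group_add, discrete_topology} \<Rightarrow>\<^sub>C complex) \<Rightarrow>\<^sub>L complex) \<Rightarrow> 'a set \<Rightarrow> 'a set \<Rightarrow> bool"
where
  "small_sumset \<nu> A B \<longleftrightarrow>
     \<nu> extreme_point_of invariant_means \<and> mean_of \<nu> (A + B) < mean_of \<nu> A + mean_of \<nu> B"

text \<open>
  If no \<open>\<nu>\<close> satisfies \<open>small_sumset \<nu> A B\<close>, then \<open>kneser_subgroup A B\<close> need not determine a
  unique subgroup: for \<open>A = B = {0}\<close> in the integers every nonzero subgroup qualifies. Uniqueness
  is therefore meaningful only when such a \<open>\<nu>\<close> exists.
\<close>

definition kneser_subgroup ::
  "'a::{ab_group_add, discrete_topology} set \<Rightarrow> 'a set \<Rightarrow> 'a set \<Rightarrow> bool" where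
  "kneser_subgroup A B K \<longleftrightarrow>
     finite_index_subgroup K \<and>
     (\<forall>\<nu>. small_sumset \<nu> A B \<longrightarrow>
        mean_of \<nu> (A + B) = mean_of \<nu> (A + B + K) \<and>
        mean_of \<nu> (A + B + K) = mean_of \<nu> (A + K) + mean_of \<nu> (B + K) - mean_of \<nu> K) \<and>
     K = stabilizer (A + B + K)"

end

theory Submission
  imports Defs
begin

text \<open>
  Let \<open>\<nu>\<close> be an extreme invariant mean. For fixed \<open>B\<close>, averaging \<open>f \<mapsto> \<nu> (f 1\<^bsub>B + e\<^esub>)\<close> over \<open>e\<close>
  gives an invariant positive functional below \<open>\<nu>\<close>, hence \<open>\<nu> B \<cdot> \<nu>\<close>; this is all the ergodicity needed.

  Put \<open>S = A + B\<close>, \<open>t = \<nu> A + \<nu> B\<close> and fix \<open>s \<in> S\<close>; after translating \<open>B\<close>, \<open>s = a\<^sub>0 + 0\<close>. Among the pairs \<open>(A', B')\<close>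
  with \<open>A' + B' \<subseteq> S\<close>, \<open>a\<^sub>0 \<in> A'\<close>, \<open>0 \<in> B'\<close>, \<open>\<nu> A' + \<nu> B' = t\<close>, a family closed under Dyson's
  \<open>e\<close>-transform, take one with \<open>\<nu> B'\<close> nearly minimal. Then \<open>a + B'\<close> is almost contained in \<open>A'\<close> for
  every \<open>a \<in> A'\<close>, and by ergodicity almost disjoint from \<open>A'\<close> for most \<open>a \<notin> A'\<close>. Hence
  \<open>\<nu> ((A' + g) - A')\<close> is either tiny or at least about \<open>\<nu> B'\<close>, so the \<open>g\<close> for which it is tiny form a
  subgroup \<open>H\<close>. It has finite index, \<open>C = A' + H\<close> is almost \<open>A'\<close>, and \<open>B'\<close> is almost contained in \<open>H\<close>.
  So \<open>s \<in> C\<close>, almost \<open>C \<subseteq> S\<close>, and almost \<open>\<nu> C + \<nu> H \<ge> t\<close>.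

  Kneser's union lemma preserves these properties for unions of such \<open>C\<close>. Finitely many unions cover
  \<open>S\<close>, and since the values of \<open>\<nu>\<close> on periodic sets of bounded index are discrete, the errors vanish:
  \<open>S \<subseteq> C\<close>, \<open>\<nu> C = \<nu> S\<close>, \<open>\<nu> C + \<nu> H \<ge> t\<close>. Then \<open>K\<close> is the stabilizer of \<open>C = S + K\<close>. It is determined
  by \<open>S\<close> because \<open>(S + K) - (S + K')\<close> is null and periodic, hence empty.
\<close>

section \<open>Periodic sets and invariant means\<close>

text \<open>The translate of \<open>X\<close> by \<open>g\<close>, given by a membership test so
  that claims about translates simplify to algebra; \<open>plus_singleton\<close> links it to set
  sums.\<close>

definition shift :: "'a::ab_group_add \<Rightarrow> 'a set \<Rightarrow> 'a set" where
  "shift g X = {x. x - g \<in> X}"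

lemma in_shift [simp]: "x \<in> shift g X \<longleftrightarrow> x - g \<in> X"
  by (simp add: shift_def)

lemma shift_shift [simp]: "shift g (shift h X) = shift (g + h) X"
  by (auto simp: diff_diff_eq)

lemma shift_Int: "shift g (X \<inter> Y) = shift g X \<inter> shift g Y"
  and shift_Diff: "shift g (X - Y) = shift g X - shift g Y"
  and shift_0 [simp]: "shift 0 X = X"
  by auto

definition is_subgroup :: "'a::ab_group_add set \<Rightarrow> bool" where
  "is_subgroup H \<longleftrightarrow> 0 \<in> H \<and> (\<forall>x\<in>H. \<forall>y\<in>H. x - y \<in> H)"

definition finite_index :: "'a::ab_group_add set \<Rightarrow> bool" where
  "finite_index H \<longleftrightarrow> finite (range (\<lambda>g. shift g H))"

text \<open>One inclusion is enough: a subgroup contains negatives, so for a subgroup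
  \<open>H\<close> this makes \<open>X\<close> a union of cosets of \<open>H\<close>.\<close>

definition periodic :: "'a::ab_group_add set \<Rightarrow> 'a set \<Rightarrow> bool" where
  "periodic H X \<longleftrightarrow> (\<forall>x\<in>X. \<forall>h\<in>H. x + h \<in> X)"

lemma subgroup_0: "is_subgroup H \<Longrightarrow> 0 \<in> H"
  and subgroup_diff: "is_subgroup H \<Longrightarrow> x \<in> H \<Longrightarrow> y \<in> H \<Longrightarrow> x - y \<in> H"
  by (auto simp: is_subgroup_def)

lemma subgroup_minus: "is_subgroup H \<Longrightarrow> x \<in> H \<Longrightarrow> - x \<in> H"
  using subgroup_diff[of H 0 x] subgroup_0[of H] by simp

lemma subgroup_add: "is_subgroup H \<Longrightarrow> x \<in> H \<Longrightarrow> y \<in> H \<Longrightarrow> x + y \<in> H"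
  using subgroup_diff[of H x "- y"] subgroup_minus[of H y] by simp

lemma subgroup_Int: "is_subgroup H \<Longrightarrow> is_subgroup K \<Longrightarrow> is_subgroup (H \<inter> K)"
  by (auto simp: is_subgroup_def)

lemma periodicD: "periodic H X \<Longrightarrow> x \<in> X \<Longrightarrow> h \<in> H \<Longrightarrow> x + h \<in> X"
  by (auto simp: periodic_def)

lemma periodic_mono: "periodic H X \<Longrightarrow> K \<subseteq> H \<Longrightarrow> periodic K X"
  by (auto simp: periodic_def)

lemma periodic_UNIV [simp]: "periodic H UNIV"
  by (auto simp: periodic_def)

lemma periodic_Un: "periodic H X \<Longrightarrow> periodic H Y \<Longrightarrow> periodic H (X \<union> Y)"
  by (auto simp: periodic_def)

lemma periodic_Diff:
  assumes "is_subgroup H" "periodic H X" "periodic H Y" shows "periodic H (X - Y)"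
proof -
  have "x + h \<notin> Y" if "x \<notin> Y" "h \<in> H" for x h
    using that periodicD[OF assms(3) _ subgroup_minus[OF assms(1) that(2)], of "x + h"] by auto
  then show ?thesis using assms(2) by (simp add: periodic_def)
qed

lemma periodic_shift: "periodic H X \<Longrightarrow> periodic H (shift g X)"
  by (simp add: periodic_def add_diff_eq diff_add_eq[symmetric])

lemma periodic_plus: "is_subgroup H \<Longrightarrow> periodic H (X + H)"
  by (auto simp: periodic_def set_plus_def) (metis add.assoc subgroup_add)

lemma subset_plus_subgroup: "is_subgroup H \<Longrightarrow> X \<subseteq> X + H"
  using set_plus_intro[OF _ subgroup_0, of _ X H] by auto

lemma plus_subset_periodic: "periodic H Y \<Longrightarrow> X \<subseteq> Y \<Longrightarrow> X + H \<subseteq> Y"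
  by (auto simp: periodic_def set_plus_def)

text \<open>Adding \<open>K\<close> to a coset of \<open>H\<close> gives the coset of
  \<open>K\<close> around it, so the finitely many cosets of \<open>H\<close> map onto those of
  \<open>K\<close>.\<close>

lemma finite_index_mono:
  assumes "finite_index H" "H \<subseteq> K" "is_subgroup H" "is_subgroup K"
  shows "finite_index K"
proof -
  have "shift g K = shift g H + K" for g
  proof (intro equalityI subsetI)
    fix x assume "x \<in> shift g K"
    moreover have "g \<in> shift g H" using subgroup_0[OF assms(3)] by simp
    ultimately show "x \<in> shift g H + K" using set_plus_intro[of g "shift g H" "x - g" K] by simp
  next
    fix x assume "x \<in> shift g H + K"
    then obtain a k where "x = a + k" "a - g \<in> H" "k \<in> K" by (auto simp: set_plus_def)
    then have "x - g = (a - g) + k" "a - g \<in> K" using assms(2) by auto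
    then have "x - g \<in> K" using subgroup_add[OF assms(4)] \<open>k \<in> K\<close> by metis
    then show "x \<in> shift g K" by simp
  qed
  then have "range (\<lambda>g. shift g K) = (\<lambda>X. X + K) ` range (\<lambda>g. shift g H)" by (simp add: image_image)
  then show ?thesis using assms(1) unfolding finite_index_def by simp
qed

lemma finite_index_Int:
  assumes "finite_index H" "finite_index K"
  shows "finite_index (H \<inter> K)"
proof -
  have "range (\<lambda>g. shift g (H \<inter> K)) \<subseteq>
      (\<lambda>(X, Y). X \<inter> Y) ` (range (\<lambda>g. shift g H) \<times> range (\<lambda>g. shift g K))"
    by (auto simp: shift_Int)
  then show ?thesis
    using assms unfolding finite_index_def by (meson finite_SigmaI finite_imageI finite_subset)
qed

lemma finite_index_if_covered:
  assumes "is_subgroup H" "finite G" "\<And>x. \<exists>g\<in>G. x - g \<in> H"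
  shows "finite_index H"
proof -
  have "shift x H \<in> (\<lambda>g. shift g H) ` G" for x
  proof -
    obtain g where g: "g \<in> G" "x - g \<in> H" using assms(3) by blast
    have "y - x \<in> H \<longleftrightarrow> y - g \<in> H" for y
      using subgroup_add[OF assms(1) _ g(2), of "y - x"] subgroup_diff[OF assms(1) _ g(2), of "y - g"]
      by auto
    then show ?thesis using g(1) by (intro image_eqI[of _ _ g]) auto
  qed
  then show ?thesis unfolding finite_index_def using assms(2) by (meson finite_imageI finite_subset image_subsetI)
qed

section \<open>Finitely additive invariant means, viewed as set functions\<close>

locale invariant_mean =
  fixes m :: "'a::ab_group_add set \<Rightarrow> real"
  assumes m_UNIV: "m UNIV = 1"
    and m_nonneg: "0 \<le> m X"
    and m_disjoint: "X \<inter> Y = {} \<Longrightarrow> m (X \<union> Y) = m X + m Y"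
    and m_shift [simp]: "m (shift g X) = m X"
begin

lemma m_split: "m X = m (X \<inter> Y) + m (X - Y)"
  using m_disjoint[of "X \<inter> Y" "X - Y"] by (simp add: Int_Diff_Un Int_Diff_disjoint)

lemma m_mono: "X \<subseteq> Y \<Longrightarrow> m X \<le> m Y"
  using m_split[of Y X] m_nonneg[of "Y - X"] by (simp add: Int_absorb1)

lemma m_modular: "m (X \<union> Y) + m (X \<inter> Y) = m X + m Y"
  using m_disjoint[of X "Y - X"] m_split[of Y X] by (simp add: Int_commute)

lemma m_Un_le: "m (X \<union> Y) \<le> m X + m Y"
  using m_modular[of X Y] m_nonneg[of "X \<inter> Y"] by linarith

lemma m_le_1: "m X \<le> 1"
  using m_mono[of X UNIV] m_UNIV by simp

lemma m_empty [simp]: "m {} = 0"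
  using m_disjoint[of "{}" "{}"] by simp

lemma m_UN_le: "finite I \<Longrightarrow> m (\<Union>i\<in>I. X i) \<le> (\<Sum>i\<in>I. m (X i))"
proof (induction I rule: finite_induct)
  case (insert i I)
  then show ?case using m_Un_le[of "X i" "\<Union>i\<in>I. X i"] by simp
qed simp

lemma m_Union_disjoint: "finite Q \<Longrightarrow> disjoint Q \<Longrightarrow> m (\<Union>Q) = (\<Sum>X\<in>Q. m X)"
proof (induction Q rule: finite_induct)
  case (insert X Q)
  have "X \<inter> \<Union>Q = {}" using insert.hyps insert.prems by (auto simp: disjoint_def)
  moreover have "disjoint Q" using insert.prems by (auto simp: disjoint_def)
  ultimately show ?case using insert m_disjoint[of X "\<Union>Q"] by simp
qed simp

text \<open>Triangle inequality for one-sided differences; together with \<open>m_Diff_swap\<close>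
  it allows chaining inclusions that hold up to a small error.\<close>

lemma m_Diff_le: "m (X - Z) \<le> m (X - Y) + m (Y - Z)"
proof -
  have "m (X - Z) \<le> m ((X - Y) \<union> (Y - Z))" by (rule m_mono) auto
  then show ?thesis using m_Un_le[of "X - Y" "Y - Z"] by linarith
qed

lemma m_Diff_swap: "m X = m Y \<Longrightarrow> m (X - Y) = m (Y - X)"
  using m_split[of X Y] m_split[of Y X] by (simp add: Int_commute)

lemma periodic_union_cosets:
  assumes H: "is_subgroup H" and X: "periodic H X"
  shows "X = (\<Union>x\<in>X. shift x H)" "disjoint ((\<lambda>x. shift x H) ` X)"
proof -
  show "X = (\<Union>x\<in>X. shift x H)"
  proof (intro equalityI subsetI)
    fix x assume "x \<in> X" then show "x \<in> (\<Union>x\<in>X. shift x H)"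
      using subgroup_0[OF H] by (intro UN_I[of x]) auto
  next
    fix y assume "y \<in> (\<Union>x\<in>X. shift x H)"
    then obtain x where "x \<in> X" "y - x \<in> H" by auto
    then show "y \<in> X" using periodicD[OF X, of x "y - x"] by simp
  qed
  have eq: "shift x H = shift y H" if "z - x \<in> H" "z - y \<in> H" for x y z
  proof -
    have "y - x \<in> H" using subgroup_diff[OF H that] by simp
    then have "w - x \<in> H \<longleftrightarrow> w - y \<in> H" for w
      using subgroup_add[OF H, of "w - y" "y - x"] subgroup_diff[OF H, of "w - x" "y - x"] by auto
    then show ?thesis unfolding shift_def by simp
  qed
  have "shift x H = shift y H" if "shift x H \<inter> shift y H \<noteq> {}" for x y
  proof -
    obtain z where "z - x \<in> H" "z - y \<in> H" using \<open>shift x H \<inter> shift y H \<noteq> {}\<close> by auto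
    then show ?thesis by (rule eq)
  qed
  then show "disjoint ((\<lambda>x. shift x H) ` X)"
    unfolding disjoint_def by blast
qed

text \<open>Counting cosets. This discreteness later turns approximate equalities into exact
  ones.\<close>

lemma periodic_multiple:
  assumes H: "is_subgroup H" "finite_index H" and X: "periodic H X"
  obtains j :: nat where "m X = real j * m H"
proof -
  have f: "finite ((\<lambda>x. shift x H) ` X)"
    using H(2) unfolding finite_index_def by (rule finite_subset[rotated]) auto
  have "m X = m (\<Union> ((\<lambda>x. shift x H) ` X))" using periodic_union_cosets(1)[OF H(1) X] by simp
  also have "\<dots> = (\<Sum>Y\<in>(\<lambda>x. shift x H) ` X. m Y)"
    by (rule m_Union_disjoint[OF f periodic_union_cosets(2)[OF H(1) X]])
  also have "\<dots> = (\<Sum>Y\<in>(\<lambda>x. shift x H) ` X. m H)" by (rule sum.cong) auto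
  finally have "m X = real (card ((\<lambda>x. shift x H) ` X)) * m H" by simp
  then show ?thesis by (rule that)
qed

lemma index_pos:
  assumes "is_subgroup H" "finite_index H"
  obtains k :: nat where "real k * m H = 1" "k > 0" "m H > 0"
proof -
  obtain k :: nat where k: "m UNIV = real k * m H" by (rule periodic_multiple[OF assms periodic_UNIV])
  then have "real k * m H \<noteq> 0" using m_UNIV by linarith
  then have "k \<noteq> 0" "m H \<noteq> 0" by auto
  then show ?thesis using k m_UNIV that[of k] m_nonneg[of H] by (simp add: neq0_conv[symmetric] del: neq0_conv)
qed

lemma periodic_nonempty:
  assumes "is_subgroup H" "periodic H X" "x \<in> X"
  shows "m H \<le> m X"
proof -
  have "shift x H \<subseteq> X" using periodic_union_cosets(1)[OF assms(1,2)] assms(3) by auto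
  then show ?thesis using m_mono[of "shift x H" X] by simp
qed

text \<open>A nonempty periodic difference would contain a whole coset and so have positive
  mean.\<close>

lemma periodic_eq:
  assumes "is_subgroup H" "finite_index H" "periodic H X" "periodic H Y" "X \<subseteq> Y" "m Y \<le> m X"
  shows "X = Y"
proof (rule ccontr)
  assume "X \<noteq> Y"
  then obtain y where "y \<in> Y - X" using assms(5) by auto
  then have "m H \<le> m (Y - X)" using periodic_nonempty periodic_Diff assms by blast
  moreover obtain k where "m H > 0" by (rule index_pos[OF assms(1,2)])
  ultimately show False using m_split[of Y X] assms(5,6) by (simp add: Int_absorb1)
qed

text \<open>Modulo \<open>H1 \<inter> H2\<close> an element of \<open>H1 + H2\<close> splits
  uniquely into its summands, so the number of cosets in \<open>P + Q\<close> is the product of the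
  numbers for \<open>P\<close> and \<open>Q\<close>.\<close>

lemma m_direct_product:
  assumes H: "is_subgroup H1" "is_subgroup H2" and f: "finite_index (H1 \<inter> H2)"
    and P: "periodic (H1 \<inter> H2) P" "P \<subseteq> H1" and Q: "periodic (H1 \<inter> H2) Q" "Q \<subseteq> H2"
  shows "m (P + Q) * m (H1 \<inter> H2) = m P * m Q"
proof -
  let ?L = "H1 \<inter> H2" and ?P = "(\<lambda>x. shift x (H1 \<inter> H2)) ` P"
  have L: "is_subgroup ?L" by (rule subgroup_Int[OF H])
  have f: "finite ?P"
    using f unfolding finite_index_def by (rule finite_subset[rotated]) auto
  have dP: "disjoint ?P" by (rule periodic_union_cosets(2)[OF L P(1)])
  have PU: "P = \<Union>?P" using periodic_union_cosets(1)[OF L P(1)] by simp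
  have "m P = m (\<Union>?P)" using PU by simp
  also have "\<dots> = (\<Sum>Y\<in>?P. m Y)" by (rule m_Union_disjoint[OF f dP])
  also have "\<dots> = (\<Sum>Y\<in>?P. m ?L)" by (rule sum.cong) auto
  finally have mP: "m P = real (card ?P) * m ?L" by simp
  have e: "shift x ?L + Q = shift x Q" for x
  proof (intro equalityI subsetI)
    fix y assume "y \<in> shift x ?L + Q"
    then obtain a q where "y = a + q" "a - x \<in> ?L" "q \<in> Q" by (auto simp: set_plus_def simp del: Int_iff)
    then show "y \<in> shift x Q" using periodicD[OF Q(1), of q "a - x"] by (simp add: algebra_simps)
  next
    fix y assume "y \<in> shift x Q"
    moreover have "x \<in> shift x ?L" using subgroup_0[OF L] by simp
    ultimately show "y \<in> shift x ?L + Q" using set_plus_intro[of x "shift x ?L" "y - x" Q] by simp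
  qed
  \<comment> \<open>The pieces of \<open>P + Q\<close> over the cosets in \<open>P\<close>: each is
    a translate of \<open>Q\<close>, and by \<open>d\<close> pieces over distinct cosets are
    disjoint.\<close>
  define T where "T = (\<lambda>Y. Y + Q) ` ?P"
  have d: "Y = Z" if "Y \<in> ?P" "Z \<in> ?P" "(Y + Q) \<inter> (Z + Q) \<noteq> {}" for Y Z
  proof -
    obtain x y where x: "x \<in> P" "Y = shift x ?L" and y: "y \<in> P" "Z = shift y ?L"
      using \<open>Y \<in> ?P\<close> \<open>Z \<in> ?P\<close> by blast
    obtain z where z: "z - x \<in> Q" "z - y \<in> Q"
      using \<open>(Y + Q) \<inter> (Z + Q) \<noteq> {}\<close> unfolding x(2) y(2) e by auto
    have "y - x \<in> H1" using subgroup_diff[OF H(1)] x y P(2) by blast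
    moreover have "y - x \<in> H2" using subgroup_diff[OF H(2), of "z - x" "z - y"] z Q(2) by auto
    ultimately have "y \<in> shift x ?L" by simp
    moreover have "y \<in> shift y ?L" using subgroup_0[OF L] by simp
    ultimately have "y \<in> Y \<inter> Z" using x y by blast
    with dP \<open>Y \<in> ?P\<close> \<open>Z \<in> ?P\<close> show ?thesis unfolding disjoint_def by blast
  qed
  have "P + Q = \<Union>T"
  proof -
    have "(\<Union>?P) + Q = \<Union>T" unfolding T_def by (auto simp: set_plus_def simp del: in_shift)
    with PU show ?thesis by simp
  qed
  also have "m \<dots> = (\<Sum>Y\<in>T. m Y)"
  proof (rule m_Union_disjoint)
    show "disjoint T"
    proof (rule disjointI)
      fix U V assume UV: "U \<in> T" "V \<in> T" "U \<noteq> V"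
      obtain Y where Y: "U = Y + Q" "Y \<in> ?P" using UV(1) unfolding T_def by (rule imageE)
      obtain Z where Z: "V = Z + Q" "Z \<in> ?P" using UV(2) unfolding T_def by (rule imageE)
      show "U \<inter> V = {}" using d[OF Y(2) Z(2)] UV(3) Y(1) Z(1) by metis
    qed
  qed (simp add: T_def f)
  also have "\<dots> = (\<Sum>Y\<in>T. m Q)"
  proof (rule sum.cong)
    fix Y assume "Y \<in> T"
    then obtain x where "Y = shift x ?L + Q" unfolding T_def by blast
    then show "m Y = m Q" unfolding e by simp
  qed simp
  also have "\<dots> = real (card T) * m Q" by simp
  finally have m1: "m (P + Q) = real (card T) * m Q" .
  show ?thesis
  \<comment> \<open>For empty \<open>Q\<close> all pieces collapse to the empty set, so counting
    them needs a point of \<open>Q\<close>.\<close>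
  proof (cases "Q = {}")
    case False
    have "inj_on (\<lambda>Y. Y + Q) ?P"
    proof (rule inj_onI)
      fix Y Z assume a: "Y \<in> ?P" "Z \<in> ?P" "Y + Q = Z + Q"
      obtain x where x: "x \<in> P" "Y = shift x ?L" using a(1) by auto
      obtain q where "q \<in> Q" using False by blast
      then have "x + q \<in> Y + Q" using x e by simp
      then show "Y = Z" using d[OF a(1,2)] a(3) by blast
    qed
    then have "card T = card ?P" unfolding T_def by (rule card_image)
    then show ?thesis using m1 mP by simp
  qed (simp add: set_plus_def)
qed

end

section \<open>Union lemma and almost stable pairs\<close>

lemma maximal_card_set:
  assumes "P {}" and "\<And>E. P E \<Longrightarrow> card E \<le> k"
  shows "\<exists>E. P E \<and> (\<forall>E'. P E' \<longrightarrow> card E' \<le> card E)"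
  by (rule ex_has_greatest_nat[of P "{}" card "Suc k"]) (use assms in \<open>auto simp: less_Suc_eq_le\<close>)

context invariant_mean
begin

text \<open>
  Modulo \<open>H1 \<inter> H2\<close> a coset of \<open>H1 + H2\<close> is a grid in which \<open>C1\<close> is a union of rows and \<open>C2\<close> a union of
  columns. If both inequalities failed, multiplying them would contradict \<open>p (a - p) \<ge> l (a - l)\<close> for
  \<open>l \<le> p \<le> a - l\<close>.
\<close>

lemma union_grid:
  assumes H: "is_subgroup H1" "is_subgroup H2" "finite_index H1" "finite_index H2"
    and C: "periodic H1 C1" "periodic H2 C2"
    and x: "x \<in> C2" "x \<notin> C1"
    and z: "z \<in> C1" "z - x \<in> H1 + H2"
    and w: "w \<notin> C2" "w - x \<in> H1 + H2"
  shows "m H1 - m (H1 \<inter> H2) \<le> m (C2 - C1) \<or> m H2 - m (H1 \<inter> H2) \<le> m (C1 - C2)"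
proof (rule ccontr)
  assume neg: "\<not> ?thesis"
  define L where "L = H1 \<inter> H2"
  \<comment> \<open>Grid coordinates: for \<open>g\<close> in \<open>H1\<close> and \<open>h\<close>
    in \<open>H2\<close>, the point \<open>x + g + h\<close> lies in \<open>C2\<close> iff
    \<open>g\<close> is in \<open>P\<close>, and outside \<open>C1\<close> iff \<open>h\<close> is
    in \<open>Q\<close>.\<close>
  define P where "P = {h \<in> H1. x + h \<in> C2}"
  define Q where "Q = {h \<in> H2. x + h \<notin> C1}"
  have L: "is_subgroup L" "finite_index L"
    unfolding L_def using H subgroup_Int finite_index_Int by auto
  have LH: "L \<subseteq> H1" "L \<subseteq> H2" by (auto simp: L_def)
  have inC1: "u + h \<in> C1 \<longleftrightarrow> u \<in> C1" if "h \<in> H1" for u h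
    using periodicD[OF C(1), of u h] periodicD[OF C(1), of "u + h" "- h"] subgroup_minus[OF H(1)] that
    by auto
  have inC2: "u + h \<in> C2 \<longleftrightarrow> u \<in> C2" if "h \<in> H2" for u h
    using periodicD[OF C(2), of u h] periodicD[OF C(2), of "u + h" "- h"] subgroup_minus[OF H(2)] that
    by auto
  have perP: "periodic L P"
    unfolding periodic_def P_def using LH inC2 subgroup_add[OF H(1)] by (auto simp: add.assoc[symmetric])
  have perQ: "periodic L Q"
    unfolding periodic_def Q_def using LH inC1 subgroup_add[OF H(2)] by (auto simp: add.assoc[symmetric])
  have perH: "periodic L H1" "periodic L H2"
    unfolding periodic_def using LH subgroup_add[OF H(1)] subgroup_add[OF H(2)] by auto
  have sub: "P \<subseteq> H1" "Q \<subseteq> H2" by (auto simp: P_def Q_def)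
  have P0: "0 \<in> P" "0 \<in> Q" using x subgroup_0 H by (auto simp: P_def Q_def)
  \<comment> \<open>The points \<open>w\<close> and \<open>z\<close> show that the complements
    \<open>H1 - P\<close> and \<open>H2 - Q\<close> are nonempty; hence all four parts have mean at
    least \<open>l\<close>.\<close>
  obtain w1 w2 where w12: "w - x = w1 + w2" "w1 \<in> H1" "w2 \<in> H2" using w(2) by (auto simp: set_plus_def)
  have "w = x + w1 + w2" using w12(1) by (simp add: algebra_simps)
  then have w1: "w1 \<in> H1 - P" using w(1) inC2[OF w12(3)] w12(2) by (simp add: P_def)
  obtain z1 z2 where z12: "z - x = z1 + z2" "z1 \<in> H1" "z2 \<in> H2" using z(2) by (auto simp: set_plus_def)
  have "z = x + z2 + z1" using z12(1) by (simp add: algebra_simps)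
  then have z2: "z2 \<in> H2 - Q" using z(1) inC1[OF z12(2)] z12(3) by (simp add: Q_def)
  define p q a b l where "p = m P" and "q = m Q" and "a = m H1" and "b = m H2" and "l = m L"
  have lp: "l > 0" unfolding l_def by (rule index_pos[OF L])
  have "l \<le> p" "l \<le> q"
    unfolding l_def p_def q_def using periodic_nonempty[OF L(1)] perP perQ P0 by auto
  moreover have mP': "m (H1 - P) = a - p" "m (H2 - Q) = b - q"
    using m_split[of H1 P] m_split[of H2 Q] sub by (auto simp: a_def b_def p_def q_def Int_absorb1)
  moreover have "l \<le> m (H1 - P)" "l \<le> m (H2 - Q)"
    unfolding l_def using periodic_nonempty[OF L(1)] periodic_Diff[OF L(1)] perH perP perQ w1 z2 by auto
  ultimately have ineq: "l \<le> p" "l \<le> q" "l \<le> a - p" "l \<le> b - q" by auto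
  have prod1: "m (P + Q) * l = p * q"
    unfolding l_def p_def q_def L_def
    by (rule m_direct_product) (use H L perP perQ sub in \<open>auto simp: L_def\<close>)
  have prod2: "m ((H1 - P) + (H2 - Q)) * l = (a - p) * (b - q)"
    unfolding mP'[symmetric] unfolding l_def L_def
    by (rule m_direct_product) (use H L perP perQ perH periodic_Diff in \<open>auto simp: L_def\<close>)
  have "shift x (P + Q) \<subseteq> C2 - C1"
  proof
    fix u assume "u \<in> shift x (P + Q)"
    then obtain g h where gh: "u - x = g + h" "g \<in> P" "h \<in> Q" by (auto simp: set_plus_def)
    have u: "u = x + g + h" "x + g + h = x + h + g" using gh(1) by (auto simp: algebra_simps)
    then show "u \<in> C2 - C1" using gh inC1[of g "x + h"] inC2[of h "x + g"]
      unfolding P_def Q_def by (metis (mono_tags, lifting) Diff_iff mem_Collect_eq)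
  qed
  then have m1: "m (P + Q) \<le> m (C2 - C1)" using m_mono m_shift by metis
  have "shift x ((H1 - P) + (H2 - Q)) \<subseteq> C1 - C2"
  proof
    fix u assume "u \<in> shift x ((H1 - P) + (H2 - Q))"
    then obtain g h where gh: "u - x = g + h" "g \<in> H1 - P" "h \<in> H2 - Q" by (auto simp: set_plus_def)
    have u: "u = x + g + h" "x + g + h = x + h + g" using gh(1) by (auto simp: algebra_simps)
    then show "u \<in> C1 - C2" using gh inC1[of g "x + h"] inC2[of h "x + g"]
      unfolding P_def Q_def by (metis (mono_tags, lifting) Diff_iff mem_Collect_eq)
  qed
  then have m2: "m ((H1 - P) + (H2 - Q)) \<le> m (C1 - C2)" using m_mono m_shift by metis
  have "m (P + Q) < a - l" "m ((H1 - P) + (H2 - Q)) < b - l"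
    using neg m1 m2 by (auto simp: a_def b_def l_def L_def)
  then have lt: "p * q < (a - l) * l" "(a - p) * (b - q) < (b - l) * l"
    using prod1 prod2 lp by (metis mult_strict_right_mono)+
  have "(p * q) * ((a - p) * (b - q)) < ((a - l) * l) * ((b - l) * l)"
    by (rule mult_strict_mono[OF lt]) (use ineq lp in auto)
  moreover have "0 \<le> (p - l) * ((a - p) - l)" "0 \<le> (q - l) * ((b - q) - l)" using ineq by auto
  then have "(a - l) * l \<le> p * (a - p)" "(b - l) * l \<le> q * (b - q)" by (auto simp: algebra_simps)
  then have "((a - l) * l) * ((b - l) * l) \<le> (p * (a - p)) * (q * (b - q))"
    by (rule mult_mono) (use ineq lp in auto)
  ultimately show False by (simp add: mult_ac)
qed

text \<open>Since \<open>m (C1 \<union> C2)\<close> exceeds \<open>m C1\<close> by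
  \<open>m (C2 - C1)\<close>, and \<open>m C2\<close> by \<open>m (C1 - C2)\<close>, either
  alternative says that \<open>m (C1 \<union> C2) + m (H1 \<inter> H2)\<close> is at least one of
  \<open>m C1 + m H1\<close> and \<open>m C2 + m H2\<close>. Cosets of \<open>H1 + H2\<close> that
  miss one set or lie inside the other are treated directly, the rest by
  \<open>union_grid\<close>.\<close>

lemma union_lemma:
  assumes H: "is_subgroup H1" "is_subgroup H2" "finite_index H1" "finite_index H2"
    and C: "periodic H1 C1" "periodic H2 C2"
    and x: "x \<in> C2" "x \<notin> C1" and y: "y \<in> C1" "y \<notin> C2"
  shows "m H1 - m (H1 \<inter> H2) \<le> m (C2 - C1) \<or> m H2 - m (H1 \<inter> H2) \<le> m (C1 - C2)"
proof -
  have pos: "m (H1 \<inter> H2) \<ge> 0" by (rule m_nonneg)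
  have notC1: "u + h \<notin> C1" if "u \<notin> C1" "h \<in> H1" for u h
    using that periodicD[OF C(1) _ subgroup_minus[OF H(1) that(2)], of "u + h"] by auto
  have notC2: "u + h \<notin> C2" if "u \<notin> C2" "h \<in> H2" for u h
    using that periodicD[OF C(2) _ subgroup_minus[OF H(2) that(2)], of "u + h"] by auto
  have sub: "shift u H1 \<subseteq> shift u (H1 + H2)" "shift u H2 \<subseteq> shift u (H1 + H2)" for u
    using set_plus_intro[OF _ subgroup_0[OF H(2)], of _ H1] set_plus_intro[OF subgroup_0[OF H(1)], of _ H2]
    by auto
  have x1: "shift x H2 \<subseteq> C2" "shift x H1 \<inter> C1 = {}"
    using periodicD[OF C(2) x(1), of "u - x" for u] notC1[OF x(2), of "u - x" for u] by auto
  have y1: "shift y H1 \<subseteq> C1" "shift y H2 \<inter> C2 = {}"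
    using periodicD[OF C(1) y(1), of "u - y" for u] notC2[OF y(2), of "u - y" for u] by auto
  consider "shift x (H1 + H2) \<inter> C1 = {}" "shift y (H1 + H2) \<inter> C2 = {}"
    | "shift x (H1 + H2) \<inter> C1 \<noteq> {}" | "shift y (H1 + H2) \<inter> C2 \<noteq> {}" by blast
  then show ?thesis
  proof cases
    \<comment> \<open>The bounds obtained are \<open>m H2\<close> for \<open>C2 - C1\<close> and
      \<open>m H1\<close> for \<open>C1 - C2\<close>; the smaller of \<open>m H1\<close> and
      \<open>m H2\<close> decides which alternative holds.\<close>
    case 1
    have "m (shift x H2) \<le> m (C2 - C1)" by (rule m_mono) (use x1 sub 1 in blast)
    moreover have "m (shift y H1) \<le> m (C1 - C2)" by (rule m_mono) (use y1 sub 1 in blast)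
    ultimately show ?thesis using pos by auto
  next
    case 2
    then obtain z where z: "z \<in> C1" "z - x \<in> H1 + H2" by auto
    show ?thesis
    proof (cases "shift x (H1 + H2) \<subseteq> C2")
      case True
      have "m (shift x H1) \<le> m (C2 - C1)" by (rule m_mono) (use x1 sub True in blast)
      then show ?thesis using pos by auto
    next
      case False
      then obtain w where "w \<notin> C2" "w - x \<in> H1 + H2" unfolding subset_iff in_shift by blast
      then show ?thesis using union_grid[OF H C x z] by blast
    qed
  next
    case 3
    then obtain z where z: "z \<in> C2" "z - y \<in> H2 + H1" by (auto simp: add.commute)
    show ?thesis
    proof (cases "shift y (H1 + H2) \<subseteq> C1")
      case True
      have "m (shift y H2) \<le> m (C1 - C2)" by (rule m_mono) (use y1 sub True in blast)
      then show ?thesis using pos by auto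
    next
      case False
      then obtain w where "w \<notin> C1" "w - y \<in> H2 + H1"
        unfolding subset_iff in_shift add.commute[of H1] by blast
      then show ?thesis
        using union_grid[OF H(2,1,4,3) C(2,1) y z] by (auto simp: Int_commute)
    qed
  qed
qed

text \<open>The index of an intersection is at most the product of the indices. This gives a uniform
  lower bound for the gain in each union step.\<close>

lemma m_subgroup_Int:
  assumes "is_subgroup H1" "is_subgroup H2" "finite_index H1" "finite_index H2"
  shows "m H1 * m H2 \<le> m (H1 \<inter> H2)"
proof -
  have "m (H1 + H2) * m (H1 \<inter> H2) = m H1 * m H2"
    by (rule m_direct_product)
      (use assms finite_index_Int subgroup_add in \<open>auto simp: periodic_def\<close>)
  moreover have "m (H1 + H2) * m (H1 \<inter> H2) \<le> 1 * m (H1 \<inter> H2)"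
    by (rule mult_right_mono[OF m_le_1 m_nonneg])
  ultimately show ?thesis by simp
qed

text \<open>A Bonferroni bound: each new set loses at most \<theta> to every earlier one. It limits
  how many translates of \<open>B\<close> can be almost disjoint.\<close>

lemma m_UN_separated:
  assumes "finite E" "\<And>e. e \<in> E \<Longrightarrow> \<delta> \<le> m (X e)" "0 \<le> \<theta>"
    and "\<And>e e'. e \<in> E \<Longrightarrow> e' \<in> E \<Longrightarrow> e \<noteq> e' \<Longrightarrow> m (X e \<inter> X e') \<le> \<theta>"
  shows "real (card E) * \<delta> - (real (card E))\<^sup>2 * \<theta> \<le> m (\<Union>e\<in>E. X e)"
  using assms(1,2,4)
proof (induction E rule: finite_induct)
  case (insert e E)
  let ?n = "real (card E)" and ?U = "\<Union>e\<in>E. X e"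
  have "m (X e \<inter> ?U) \<le> (\<Sum>e'\<in>E. m (X e \<inter> X e'))"
    using m_UN_le[OF insert.hyps(1), of "\<lambda>e'. X e \<inter> X e'"] by simp
  also have "\<dots> \<le> (\<Sum>e'\<in>E. \<theta>)"
    by (rule sum_mono) (use insert.prems(2) insert.hyps(2) in auto)
  finally have "m (X e \<inter> ?U) \<le> ?n * \<theta>" by simp
  moreover have "?n * \<delta> - ?n\<^sup>2 * \<theta> \<le> m ?U" using insert by auto
  moreover have "\<delta> \<le> m (X e)" using insert.prems(1) by auto
  moreover have "0 \<le> ?n * \<theta>" using assms(3) by simp
  ultimately have "?n * \<delta> + \<delta> - (?n\<^sup>2 * \<theta> + 2 * (?n * \<theta>) + \<theta>) \<le> m (X e \<union> ?U)"
    using m_modular[of "X e" ?U] assms(3) by linarith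
  then show ?case using insert.hyps by (simp add: power2_eq_square algebra_simps)
qed simp

end

text \<open>
  The last axiom is the ergodic theorem stripped of integrals: \<open>e \<mapsto> m (A \<inter> shift e B)\<close> has
  mean \<open>m A * m B\<close>, and it dominates \<open>c\<close> on \<open>A\<close> and \<open>d\<close> on \<open>Z\<close>.
\<close>

locale ergodic_mean = invariant_mean +
  assumes ergodic: "A \<inter> Z = {} \<Longrightarrow> (\<And>e. e \<in> A \<Longrightarrow> c \<le> m (A \<inter> shift e B)) \<Longrightarrow>
    (\<And>e. e \<in> Z \<Longrightarrow> d \<le> m (A \<inter> shift e B)) \<Longrightarrow> c * m A + d * m Z \<le> m A * m B"
begin

text \<open>
  The index of \<open>H\<close> is bounded by pigeonhole: away from the exceptional points, membership of \<open>e\<close> in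
  a translate of \<open>A\<close> can be read off from any \<open>e'\<close> for which \<open>e + B\<close> and \<open>e' + B\<close> overlap noticeably,
  and at most \<open>M\<close> such translates of \<open>B\<close> can be almost disjoint.
\<close>

lemma almost_stable:
  fixes \<eta> \<delta> :: real and M :: nat
  assumes M: "2 \<le> real M * \<delta>" and \<eta>: "0 < \<eta>" "2 * (real M)\<^sup>2 * \<eta> < 1" "(2 ^ M + 3) * \<eta> < \<delta>"
    and B: "\<delta> \<le> m B" and stab: "\<And>a. a \<in> A \<Longrightarrow> m (shift a B - A) \<le> \<eta>\<^sup>2"
  obtains H C where "is_subgroup H" "finite_index H" "periodic H C" "A \<subseteq> C" "m (C - A) \<le> \<eta>"
    "m (B - H) \<le> 2 ^ M * (2 * \<eta>)"
proof -
  have "1 * \<eta> \<le> 2 ^ M * \<eta>" by (rule mult_right_mono) (use \<eta> in auto)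
  then have \<eta>4: "4 * \<eta> < \<delta>" using \<eta>(3) by (simp add: algebra_simps)
  have "\<delta> \<le> 1" using B m_le_1[of B] by simp
  then have \<eta>1: "\<eta> < 1" using \<eta>4 \<eta> by simp
  have sq: "\<eta>\<^sup>2 \<le> \<eta>" using \<eta> \<eta>1 by (simp add: power2_eq_square)
  define Bad where "Bad = {e. e \<notin> A \<and> \<eta> \<le> m (A \<inter> shift e B)}"
  \<comment> \<open>On \<open>A\<close> the overlap is nearly all of \<open>B\<close>, on
    \<open>Bad\<close> at least \<eta>. The error \<open>\<eta>\<^sup>2\<close> in
    \<open>stab\<close> is chosen so that dividing by \<eta> still leaves
    \<open>m Bad \<le> \<eta>\<close>.\<close>
  have "(m B - \<eta>\<^sup>2) * m A + \<eta> * m Bad \<le> m A * m B"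
  proof (rule ergodic)
    fix e assume "e \<in> A"
    then show "m B - \<eta>\<^sup>2 \<le> m (A \<inter> shift e B)"
      using stab[of e] m_split[of "shift e B" A] by (simp add: Int_commute)
  qed (auto simp: Bad_def)
  then have "\<eta> * m Bad \<le> \<eta>\<^sup>2 * m A" by (simp add: algebra_simps)
  also have "\<dots> \<le> \<eta>\<^sup>2 * 1" by (rule mult_left_mono[OF m_le_1]) simp
  finally have mBad: "m Bad \<le> \<eta>" using \<eta>(1) by (simp add: power2_eq_square)
  have inA: "m (shift e B - A) \<le> \<eta>" if "e \<in> A" for e using stab[OF that] sq by simp
  have outA: "m (shift e B \<inter> A) < \<eta>" if "e \<notin> A" "e \<notin> Bad" for e
    using that by (auto simp: Bad_def Int_commute not_le)
  have inA': "m (shift e B - shift g A) \<le> \<eta>" if "e - g \<in> A" for e g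
    using inA[OF that] m_shift[of g "shift (e - g) B - A"] unfolding shift_Diff shift_shift by simp
  have outA': "m (shift e B \<inter> shift g A) < \<eta>" if "e - g \<notin> A" "e - g \<notin> Bad" for e g
    using outA[OF that] m_shift[of g "shift (e - g) B \<inter> A"] unfolding shift_Int shift_shift by simp
  \<comment> \<open>If the difference is too large to fit into \<open>Bad\<close>, it belongs to
    some good \<open>e\<close> with \<open>e + B\<close> almost inside \<open>A + g\<close> and
    almost disjoint from \<open>A\<close>, so most of \<open>e + B\<close> lies in the
    difference.\<close>
  have gap: "\<delta> - 2 * \<eta> \<le> m (shift g A - A)" if "\<eta> < m (shift g A - A)" for g
  proof -
    have "\<not> shift g A - A \<subseteq> Bad" using that mBad m_mono[of "shift g A - A" Bad] by linarith
    then obtain e where e: "e - g \<in> A" "e \<notin> A" "e \<notin> Bad"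
      unfolding subset_iff Diff_iff in_shift by blast
    have "m (shift e B) = m (shift e B \<inter> A) + m (shift e B - A)" by (rule m_split)
    moreover have "m (shift e B - A) \<le> m (shift e B - shift g A) + m (shift g A - A)" by (rule m_Diff_le)
    ultimately show ?thesis using inA'[OF e(1)] outA[OF e(2,3)] B by simp
  qed
  \<comment> \<open>Adding two errors gives at most \<open>2 * \<eta>\<close>, which is below
    \<open>\<delta> - 2 * \<eta>\<close>; by \<open>gap\<close> the error is then at most \<eta>
    again, which makes \<open>H\<close> a subgroup.\<close>
  define H where "H = {g. m (shift g A - A) \<le> \<eta>}"
  have H: "is_subgroup H"
    unfolding is_subgroup_def
  proof (intro conjI ballI)
    show "0 \<in> H" using \<eta>(1) by (simp add: H_def)
    fix x y assume xy: "x \<in> H" "y \<in> H"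
    have "m (shift (x - y) A - shift (- y) A) = m (shift x A - A)"
      using m_shift[of "- y" "shift x A - A"] unfolding shift_Diff shift_shift by simp
    moreover have "m (shift (- y) A - A) = m (A - shift y A)"
      using m_shift[of "- y" "A - shift y A"] unfolding shift_Diff shift_shift by simp
    moreover have "m (A - shift y A) = m (shift y A - A)" by (rule m_Diff_swap) simp
    ultimately have "m (shift (x - y) A - A) \<le> 2 * \<eta>"
      using xy m_Diff_le[of "shift (x - y) A" A "shift (- y) A"] by (simp add: H_def)
    then show "x - y \<in> H" using gap[of "x - y"] \<eta>4 by (force simp: H_def)
  qed
  define sep where "sep G \<longleftrightarrow> finite G \<and> (\<forall>g\<in>G. \<forall>g'\<in>G. g \<noteq> g' \<longrightarrow> g - g' \<notin> H)" for G
  have bound: "card G \<le> 2 ^ M" if "sep G" for G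
  proof (rule ccontr)
    assume "\<not> card G \<le> 2 ^ M"
    then have "2 ^ M + 1 \<le> card G" by simp
    then obtain G' where G'c: "card G' = 2 ^ M + 1" "G' \<subseteq> G"
      by (meson obtain_subset_with_card_n)
    then have "sep G'" using that unfolding sep_def by (meson finite_subset subset_iff)
    then have G': "sep G'" "finite G'" "card G' = 2 ^ M + 1" using G'c(1) by (auto simp: sep_def)
    \<comment> \<open>For \<open>e\<close> in \<open>W\<close> and \<open>g\<close> in
      \<open>G'\<close>, the set \<open>e + B\<close> is either almost inside or almost disjoint
      from \<open>A + g\<close>.\<close>
    define W where "W = - (\<Union>g\<in>G'. shift g Bad)"
    have W: "e - g \<notin> Bad" if "e \<in> W" "g \<in> G'" for e g using that by (auto simp: W_def)
    have "m (\<Union>g\<in>G'. shift g Bad) \<le> (\<Sum>g\<in>G'. m (shift g Bad))" by (rule m_UN_le[OF G'(2)])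
    also have "\<dots> \<le> (\<Sum>g\<in>G'. \<eta>)" by (rule sum_mono) (use mBad in simp)
    finally have mW: "m (- W) \<le> (2 ^ M + 1) * \<eta>" using G'(3) by (simp add: W_def add.commute)
    define far where "far E \<longleftrightarrow> finite E \<and> E \<subseteq> W \<and>
      (\<forall>e\<in>E. \<forall>e'\<in>E. e \<noteq> e' \<longrightarrow> m (shift e B \<inter> shift e' B) \<le> 2 * \<eta>)" for E
    have farM: "card E \<le> M" if "far E" for E
    proof (rule ccontr)
      assume "\<not> card E \<le> M"
      then obtain E' where E': "card E' = M" "E' \<subseteq> E" by (meson nle_le obtain_subset_with_card_n)
      have "finite E'" using E' that finite_subset by (auto simp: far_def)
      \<comment> \<open>With exactly \<open>M\<close> members the lower bound is more than
        \<open>2 - 1\<close>, exceeding the total mean.\<close>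
      then have "real (card E') * \<delta> - (real (card E'))\<^sup>2 * (2 * \<eta>) \<le> m (\<Union>e\<in>E'. shift e B)"
        by (rule m_UN_separated) (use E'(2) that B \<eta>(1) in \<open>auto simp: far_def\<close>)
      then show False using M \<eta>(2) E'(1) m_le_1[of "\<Union>e\<in>E'. shift e B"] by simp
    qed
    have "far {}" by (simp add: far_def)
    from maximal_card_set[of far, OF this farM]
    obtain E where E: "far E" and Emax: "\<And>E'. far E' \<Longrightarrow> card E' \<le> card E" by metis
    have fE: "finite E" using E by (simp add: far_def)
    have near: "\<exists>e'\<in>E. 2 * \<eta> < m (shift e B \<inter> shift e' B)" if "e \<in> W" "e \<notin> E" for e
    proof (rule ccontr)
      assume "\<not> ?thesis"
      then have "far (insert e E)" using E that(1) by (auto simp: far_def not_less Int_commute)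
      then show False using Emax[of "insert e E"] that(2) fE by simp
    qed
    \<comment> \<open>Pigeonhole: \<open>G'\<close> has \<open>2 ^ M + 1\<close> elements but
      \<open>E\<close> at most \<open>2 ^ M\<close> subsets, so two translates of \<open>A\<close>
      have the same trace on \<open>E\<close>. By maximality of \<open>E\<close>,
      \<open>near\<close> and \<open>same\<close> carry the agreement over to all of
      \<open>W\<close>.\<close>
    have "card ((\<lambda>g. {e \<in> E. e - g \<in> A}) ` G') \<le> card (Pow E)"
      by (rule card_mono) (use fE in auto)
    also have "\<dots> \<le> 2 ^ M" using farM[OF E] fE by (simp add: card_Pow)
    finally have "\<not> inj_on (\<lambda>g. {e \<in> E. e - g \<in> A}) G'" using G'(3) by (auto dest: card_image)
    then obtain g g' where g: "g \<in> G'" "g' \<in> G'" "g \<noteq> g'"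
      and eqE: "\<And>e. e \<in> E \<Longrightarrow> e - g \<in> A \<longleftrightarrow> e - g' \<in> A"
      unfolding inj_on_def by blast
    have same: "e - h \<in> A \<longleftrightarrow> e' - h \<in> A"
      if "2 * \<eta> < m (shift e B \<inter> shift e' B)" "e \<in> W" "e' \<in> W" "h \<in> G'" for e e' h
    proof -
      have "m (shift e B \<inter> shift e' B) \<le> 2 * \<eta>" if "e - h \<in> A" "e' - h \<notin> A" "e' \<in> W" for e e'
      proof -
        have "m (shift e B \<inter> shift e' B) \<le> m ((shift e B - shift h A) \<union> (shift e' B \<inter> shift h A))"
          by (rule m_mono) blast
        also have "\<dots> \<le> m (shift e B - shift h A) + m (shift e' B \<inter> shift h A)" by (rule m_Un_le)
        finally show ?thesis using inA'[OF that(1)] outA'[OF that(2) W[OF that(3) \<open>h \<in> G'\<close>]] by simp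
      qed
      from this[of e e'] this[of e' e] that show ?thesis by (auto simp: Int_commute)
    qed
    have "e - g \<in> A \<longleftrightarrow> e - g' \<in> A" if "e \<in> W" for e
    proof (cases "e \<in> E")
      case False
      then obtain e' where e': "e' \<in> E" "2 * \<eta> < m (shift e B \<inter> shift e' B)" using near \<open>e \<in> W\<close> by blast
      have "e' \<in> W" using E e'(1) by (auto simp: far_def)
      from same[OF e'(2) \<open>e \<in> W\<close> this g(1)] same[OF e'(2) \<open>e \<in> W\<close> this g(2)] eqE[OF e'(1)]
      show ?thesis by simp
    qed (rule eqE)
    then have "shift g A - shift g' A \<subseteq> - W" by auto
    from order_trans[OF m_mono[OF this] mW]
    have "m (shift g A - shift g' A) \<le> (2 ^ M + 1) * \<eta>" .
    moreover have "m (shift g A - shift g' A) = m (shift (g - g') A - A)"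
      using m_shift[of g' "shift (g - g') A - A"] unfolding shift_Diff shift_shift by simp
    moreover have "\<eta> < m (shift (g - g') A - A)" using g G'(1) by (force simp: sep_def H_def)
    ultimately show False using gap[of "g - g'"] \<eta>(3) by (simp add: algebra_simps)
  qed
  have "sep {}" by (simp add: sep_def)
  from maximal_card_set[of sep, OF this bound]
  obtain G where G: "sep G" and Gmax: "\<And>G'. sep G' \<Longrightarrow> card G' \<le> card G" by metis
  have fG: "finite G" using G by (simp add: sep_def)
  have cover: "\<exists>g\<in>G. x - g \<in> H" for x
  proof (rule ccontr)
    assume neg: "\<not> ?thesis"
    then have "x \<notin> G" using subgroup_0[OF H] by force
    moreover have "g - x \<notin> H" "x - g \<notin> H" if "g \<in> G" for g
      using neg that subgroup_minus[OF H, of "g - x"] by auto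
    then have "sep (insert x G)" using G unfolding sep_def by (simp del: right_minus_eq)
    ultimately show False using Gmax[of "insert x G"] fG by simp
  qed
  have fi: "finite_index H" by (rule finite_index_if_covered[OF H fG cover])
  define C where "C = A + H"
  have C: "periodic H C" unfolding C_def by (rule periodic_plus[OF H])
  have AC: "A \<subseteq> C" unfolding C_def by (rule subset_plus_subgroup[OF H])
  have near: "m (shift e B - A) \<le> 2 * \<eta>" if "e \<in> C" for e
  proof -
    obtain a h where ah: "e = a + h" "a \<in> A" "h \<in> H" using \<open>e \<in> C\<close> unfolding C_def by (rule set_plus_elim)
    have "m (shift e B - A) \<le> m (shift e B - shift h A) + m (shift h A - A)" by (rule m_Diff_le)
    then show ?thesis using inA'[of e h] ah by (simp add: H_def)
  qed
  \<comment> \<open>Outside \<open>Bad\<close>, a point of \<open>C - A\<close> would have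
    \<open>e + B\<close> both almost inside and almost disjoint from \<open>A\<close>, forcing
    \<open>m B < 3 * \<eta>\<close>.\<close>
  have "e \<in> Bad" if "e \<in> C" "e \<notin> A" for e
  proof (rule ccontr)
    assume "e \<notin> Bad"
    from outA[OF that(2) this] near[OF that(1)] m_split[of "shift e B" A] show False
      using B \<eta>4 \<eta>(1) by simp
  qed
  then have "C - A \<subseteq> Bad" by blast
  then have mC: "m (C - A) \<le> \<eta>" using mBad m_mono[of "C - A" Bad] by linarith
  \<comment> \<open>A large part of \<open>B\<close> in the coset \<open>r + H\<close> would push
    every \<open>e\<close> in \<open>C\<close> to a coset \<open>e + r + H\<close> meeting
    \<open>C\<close>. Then \<open>C + r\<close> lies in \<open>C\<close>, so \<open>A + r\<close> is
    almost inside \<open>A\<close> and \<open>r\<close> is in \<open>H\<close>.\<close>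
  have small: "m (B \<inter> shift r H) \<le> 2 * \<eta>" if r: "r \<notin> H" for r
  proof (rule ccontr)
    assume big: "\<not> ?thesis"
    have "e + r \<in> C" if e: "e \<in> C" for e
    proof -
      have "m (shift e B - C) \<le> m (shift e B - A)" by (rule m_mono) (use AC in auto)
      then have "\<not> shift e (B \<inter> shift r H) \<subseteq> shift e B - C"
        using m_mono[of "shift e (B \<inter> shift r H)" "shift e B - C"] big near[OF e] by auto
      then obtain x where x: "x - e - r \<in> H" "x \<in> C" by auto
      show ?thesis using periodicD[OF C x(2) subgroup_minus[OF H x(1)]] by (simp add: add.commute)
    qed
    from this[of "x - r" for x] have "shift r A - A \<subseteq> C - A" using AC by auto
    then show False using r mC m_mono[of "shift r A - A" "C - A"] by (simp add: H_def)
  qed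
  have "B - H \<subseteq> (\<Union>r\<in>G - H. B \<inter> shift r H)"
  proof
    fix b assume b: "b \<in> B - H"
    obtain r where r: "r \<in> G" "b - r \<in> H" using cover by blast
    then have "r \<notin> H" using subgroup_add[OF H, of "b - r" r] b by auto
    then show "b \<in> (\<Union>r\<in>G - H. B \<inter> shift r H)" using r b by auto
  qed
  then have "m (B - H) \<le> m (\<Union>r\<in>G - H. B \<inter> shift r H)" by (rule m_mono)
  also have "\<dots> \<le> (\<Sum>r\<in>G - H. m (B \<inter> shift r H))" by (rule m_UN_le) (use fG in simp)
  also have "\<dots> \<le> (\<Sum>r\<in>G - H. 2 * \<eta>)" by (rule sum_mono) (use small in auto)
  also have "\<dots> = real (card (G - H)) * (2 * \<eta>)" by simp
  also have "\<dots> \<le> 2 ^ M * (2 * \<eta>)"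
  proof (rule mult_right_mono)
    have "card (G - H) \<le> 2 ^ M" using bound[OF G] card_mono[of G "G - H"] fG by auto
    then have "real (card (G - H)) \<le> real (2 ^ M)" by (rule of_nat_mono)
    then show "real (card (G - H)) \<le> 2 ^ M" by simp
  qed (use \<eta>(1) in simp)
  finally show ?thesis using that[OF H fi C AC mC] by simp
qed

end

section \<open>Small sumsets for ergodic means\<close>

context ergodic_mean
begin

lemma local_component_0:
  assumes S: "A + B \<subseteq> S" and a0: "a0 \<in> A" and B0: "0 \<in> B"
    and small: "m S < m A + m B" and \<epsilon>: "\<epsilon> > 0"
  obtains H C where "is_subgroup H" "finite_index H" "periodic H C" "a0 \<in> C"
    "m (C - S) \<le> \<epsilon>" "m A + m B - \<epsilon> \<le> m C + m H"
proof -
  define \<delta> where "\<delta> = m A + m B - m S"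
  have \<delta>: "\<delta> > 0" using small by (simp add: \<delta>_def)
  obtain M :: nat where "2 / \<delta> \<le> real M" using real_arch_simple by blast
  then have M: "2 \<le> real M * \<delta>" using \<delta> by (simp add: field_simps)
  \<comment> \<open>The first two terms secure the smallness hypotheses of
    \<open>almost_stable\<close>, the third makes its error terms at most \<epsilon>.\<close>
  define \<eta> where "\<eta> = min (min (1 / (2 * (real M)\<^sup>2 + 1)) (\<delta> / (2 ^ M + 4))) (\<epsilon> / (2 ^ M * 2 + 1))"
  have pos: "(2::real) ^ M > 0" by simp
  have den: "2 * (real M)\<^sup>2 + 1 > 0" "(2::real) ^ M + 4 > 0" "(2::real) ^ M * 2 + 1 > 0"
    using pos by (auto intro: add_nonneg_pos)
  have \<eta>0: "\<eta> > 0" unfolding \<eta>_def using \<delta> \<epsilon> den by simp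
  have "\<eta> \<le> 1 / (2 * (real M)\<^sup>2 + 1)" "\<eta> \<le> \<delta> / (2 ^ M + 4)" "\<eta> \<le> \<epsilon> / (2 ^ M * 2 + 1)"
    unfolding \<eta>_def by auto
  then have "\<eta> * (2 * (real M)\<^sup>2 + 1) \<le> 1" "\<eta> * (2 ^ M + 4) \<le> \<delta>" "\<eta> * (2 ^ M * 2 + 1) \<le> \<epsilon>"
    using den by (simp_all only: pos_le_divide_eq)
  then have "2 * ((real M)\<^sup>2 * \<eta>) + \<eta> \<le> 1" "2 ^ M * \<eta> + 4 * \<eta> \<le> \<delta>" "2 * (2 ^ M * \<eta>) + \<eta> \<le> \<epsilon>"
    by (simp_all add: algebra_simps)
  moreover have "0 < 2 ^ M * \<eta>" using \<eta>0 by simp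
  ultimately have "2 * ((real M)\<^sup>2 * \<eta>) < 1" "2 ^ M * \<eta> + 3 * \<eta> < \<delta>" "2 * (2 ^ M * \<eta>) \<le> \<epsilon>" "\<eta> \<le> \<epsilon>"
    using \<eta>0 by linarith+
  then have \<eta>: "2 * (real M)\<^sup>2 * \<eta> < 1" "(2 ^ M + 3) * \<eta> < \<delta>" "2 ^ M * (2 * \<eta>) \<le> \<epsilon>" "\<eta> \<le> \<epsilon>"
    by (simp_all add: algebra_simps)
  define pair where "pair A' B' \<longleftrightarrow> A' + B' \<subseteq> S \<and> a0 \<in> A' \<and> 0 \<in> B' \<and> m A' + m B' = m A + m B" for A' B'
  let ?X = "{m B' |A' B'. pair A' B'}"
  have "pair A B" using S a0 B0 by (simp add: pair_def)
  then have ne: "?X \<noteq> {}" by blast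
  have bdd: "bdd_below ?X" by (rule bdd_belowI[of _ 0]) (use m_nonneg in blast)
  \<comment> \<open>The infimum need not be attained; the slack \<open>\<eta>\<^sup>2\<close>
    becomes the error in \<open>stab\<close>.\<close>
  have "Inf ?X < Inf ?X + \<eta>\<^sup>2" using \<eta>0 by simp
  then obtain v where v: "v \<in> ?X" "v < Inf ?X + \<eta>\<^sup>2" using cInf_lessD[OF ne] by blast
  then obtain A' B' where p: "pair A' B'" and inf: "m B' < Inf ?X + \<eta>\<^sup>2" by auto
  note p' = p[unfolded pair_def]
  have stab: "m (shift a B' - A') \<le> \<eta>\<^sup>2" if a: "a \<in> A'" for a
  proof -
    \<comment> \<open>Dyson's transform at \<open>a\<close>. Modularity preserves the sum of the
      means, and the second set loses exactly \<open>m (shift a B' - A')\<close>, which near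
      minimality bounds.\<close>
    define A'' B'' where "A'' = A' \<union> shift a B'" and "B'' = B' \<inter> shift (- a) A'"
    have mB: "m B'' = m (A' \<inter> shift a B')"
      using m_shift[of a B''] unfolding B''_def shift_Int shift_shift by (simp add: Int_commute)
    have "pair A'' B''"
      unfolding pair_def
    proof (intro conjI)
      show "A'' + B'' \<subseteq> S"
      proof
        fix s assume "s \<in> A'' + B''"
        then obtain u w where s: "s = u + w" "u \<in> A''" "w \<in> B''" by (auto simp: set_plus_def)
        then consider "u \<in> A'" "w \<in> B'" | "u - a \<in> B'" "w + a \<in> A'"
          by (auto simp: A''_def B''_def)
        then have "s \<in> A' + B'"
        proof cases
          case 2
          then have "(w + a) + (u - a) \<in> A' + B'" by (rule set_plus_intro[rotated])
          then show ?thesis using s(1) by (simp add: add.commute)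
        qed (use s in \<open>auto intro: set_plus_intro\<close>)
        then show "s \<in> S" using p' by blast
      qed
      show "m A'' + m B'' = m A + m B" using p' m_modular[of A' "shift a B'"] mB by (simp add: A''_def)
    qed (use p' a in \<open>auto simp: A''_def B''_def\<close>)
    then have "Inf ?X \<le> m B''" by (intro cInf_lower bdd) blast
    then show ?thesis using inf mB m_split[of "shift a B'" A'] by (simp add: Int_commute)
  qed
  have "A' \<subseteq> S" using p' set_plus_intro[of _ A' 0 B'] by force
  then have A'S: "m A' \<le> m S" by (rule m_mono)
  \<comment> \<open>The sum of the two means is fixed and \<open>m A'\<close> cannot exceed
    \<open>m S\<close>, so \<open>B'\<close> stays large however small it is chosen.\<close>
  then have "\<delta> \<le> m B'" using p' by (simp add: \<delta>_def)
  from almost_stable[OF M \<eta>0 \<eta>(1,2) this stab]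
  obtain H C where HC: "is_subgroup H" "finite_index H" "periodic H C" "A' \<subseteq> C" "m (C - A') \<le> \<eta>"
    "m (B' - H) \<le> 2 ^ M * (2 * \<eta>)" by blast
  have "m (C - S) \<le> m (C - A')" by (rule m_mono) (use \<open>A' \<subseteq> S\<close> in auto)
  then have 1: "m (C - S) \<le> \<epsilon>" using HC(5) \<eta>(4) by simp
  have "m B' \<le> m H + m (B' - H)" using m_split[of B' H] m_mono[of "B' \<inter> H" H] by simp
  moreover have "m A' \<le> m C" by (rule m_mono[OF HC(4)])
  ultimately have 2: "m A + m B - \<epsilon> \<le> m C + m H" using HC(6) \<eta>(3) p' by linarith
  show ?thesis by (rule that[OF HC(1-3) _ 1 2]) (use HC(4) p' in blast)
qed

lemma local_component:
  assumes S: "A + B \<subseteq> S" and s: "s \<in> A + B" and small: "m S < m A + m B" and \<epsilon>: "\<epsilon> > 0"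
  obtains H C where "is_subgroup H" "finite_index H" "periodic H C" "s \<in> C"
    "m (C - S) \<le> \<epsilon>" "m A + m B - \<epsilon> \<le> m C + m H"
proof -
  obtain a b where ab: "s = a + b" "a \<in> A" "b \<in> B" using s by (auto simp: set_plus_def)
  have "A + shift (- b) B \<subseteq> shift (- b) S"
  proof
    fix x assume "x \<in> A + shift (- b) B"
    then obtain u v where "x = u + v" "u \<in> A" "v + b \<in> B" by (auto simp: set_plus_def)
    then show "x \<in> shift (- b) S" using S set_plus_intro[of u A "v + b" B] by (auto simp: add.assoc)
  qed
  from local_component_0[OF this ab(2) _ _ \<epsilon>]
  obtain H C where HC: "is_subgroup H" "finite_index H" "periodic H C" "a \<in> C"
    "m (C - shift (- b) S) \<le> \<epsilon>" "m A + m B - \<epsilon> \<le> m C + m H" using small ab(3) by auto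
  show ?thesis
  proof (rule that[OF HC(1,2) periodic_shift[OF HC(3), of b]])
    show "s \<in> shift b C" using HC(4) ab(1) by simp
    show "m (shift b C - S) \<le> \<epsilon>"
      using HC(5) m_shift[of b "C - shift (- b) S"] unfolding shift_Diff shift_shift by simp
    show "m A + m B - \<epsilon> \<le> m (shift b C) + m H" using HC(6) by simp
  qed
qed

lemma kneser_component:
  assumes ne: "A \<noteq> {}" "B \<noteq> {}" and small: "m (A + B) < m A + m B"
  obtains H C where "is_subgroup H" "finite_index H" "periodic H C" "A + B \<subseteq> C"
    "m C = m (A + B)" "m A + m B \<le> m C + m H"
proof -
  define S where "S = A + B"
  define t where "t = m A + m B"
  define \<delta> where "\<delta> = t - m S"
  have \<delta>: "\<delta> > 0" using small by (simp add: \<delta>_def t_def S_def)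
  obtain N :: nat where "2 / \<delta> \<le> real N" using real_arch_simple by blast
  then have N: "2 \<le> real N * \<delta>" using \<delta> by (simp add: field_simps)
  \<comment> \<open>All values that \<open>m C\<close> and \<open>m C + m H\<close> can take when
    \<open>H\<close> has index \<open>k\<close> at most \<open>N\<close>; the bound
    \<open>N + 1\<close> allows for the extra coset in \<open>m C + m H\<close>. The constants
    \<open>e1\<close> and \<open>e2\<close> isolate \<open>m S\<close> and \<open>t\<close> from the
    other values.\<close>
  define V where "V = (\<lambda>(j, k). real j / real k) ` ({..N + 1} \<times> {..N})"
  have V: "finite V" by (simp add: V_def)
  obtain e1 where e1: "e1 > 0" "\<And>v. v \<in> V \<Longrightarrow> v \<noteq> m S \<Longrightarrow> e1 \<le> dist (m S) v"
    using finite_set_avoid[OF V, of "m S"] by blast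
  obtain e2 where e2: "e2 > 0" "\<And>v. v \<in> V \<Longrightarrow> v \<noteq> t \<Longrightarrow> e2 \<le> dist t v"
    using finite_set_avoid[OF V, of t] by blast
  define \<kappa> where "\<kappa> = (\<delta> / 2)\<^sup>2" \<comment> \<open>every union step gains at least \<open>m (H \<inter> H') \<ge> m H * m H'\<close>\<close>
  have \<kappa>: "\<kappa> > 0" using \<delta> by (simp add: \<kappa>_def)
  \<comment> \<open>After \<open>n0\<close> gains of at least \<kappa> the mean would reach 2, so
    \<open>S\<close> must be covered by then.\<close>
  obtain n0 :: nat where "2 / \<kappa> \<le> real n0" using real_arch_simple by blast
  then have n0: "2 \<le> real n0 * \<kappa>" using \<kappa> by (simp add: field_simps)
  \<comment> \<open>The errors accumulated in \<open>n0\<close> unions must stay below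
    \<open>\<delta> / 2\<close>, which keeps the index bounded, and below \<open>e1\<close> and
    \<open>e2\<close>.\<close>
  define \<epsilon> where "\<epsilon> = min (\<delta> / 2) (min e1 e2 / 2) / (real n0 + 2)"
  have \<epsilon>: "\<epsilon> > 0" using \<delta> e1(1) e2(1) by (simp add: \<epsilon>_def)
  have \<epsilon>n0: "(real n0 + 2) * \<epsilon> = min (\<delta> / 2) (min e1 e2 / 2)" by (simp add: \<epsilon>_def)
  have mult_le: "(real n + 2) * \<epsilon> \<le> (real n0 + 2) * \<epsilon>" if "n \<le> n0" for n
    by (rule mult_right_mono) (use that \<epsilon> in auto)
  have mH: "\<delta> / 2 \<le> m H" if "m (C - S) \<le> (real n + 1) * \<epsilon>" "t - \<epsilon> \<le> m C + m H" "n \<le> n0" for C H n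
  proof -
    have "m C \<le> m S + m (C - S)" using m_split[of C S] m_mono[of "C \<inter> S" S] by simp
    moreover have "(real n + 2) * \<epsilon> \<le> \<delta> / 2" using mult_le[OF that(3)] \<epsilon>n0 by simp
    ultimately show ?thesis using that(1,2) by (simp add: \<delta>_def algebra_simps)
  qed
  have local: "\<exists>H C. is_subgroup H \<and> finite_index H \<and> periodic H C \<and> s \<in> C \<and> m (C - S) \<le> \<epsilon> \<and>
      t - \<epsilon> \<le> m C + m H" if "s \<in> S" for s
    unfolding S_def t_def
    by (rule local_component[OF order_refl that[unfolded S_def] small \<epsilon>]) blast
  \<comment> \<open>While \<open>S\<close> is not covered, the component of an uncovered point is
    added. The outside error grows by \<epsilon> per step, but the union lemma keeps the deficit in
    \<open>t - \<epsilon> \<le> m C + m H\<close> from growing.\<close>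
  have chain: "\<exists>H C. is_subgroup H \<and> finite_index H \<and> periodic H C \<and> m (C - S) \<le> (real n + 1) * \<epsilon> \<and>
      t - \<epsilon> \<le> m C + m H \<and> (S \<subseteq> C \<or> real n * \<kappa> \<le> m C)" if "n \<le> n0" for n
    using that
  proof (induction n)
    case 0
    have "S \<noteq> {}" using ne by (auto simp: S_def set_plus_def)
    then show ?case using local m_nonneg by fastforce
  next
    case (Suc n)
    then obtain H C where H: "is_subgroup H" "finite_index H" "periodic H C"
      and C: "m (C - S) \<le> (real n + 1) * \<epsilon>" "t - \<epsilon> \<le> m C + m H" "S \<subseteq> C \<or> real n * \<kappa> \<le> m C"
      by auto
    have step: "(real n + 1) * \<epsilon> + \<epsilon> = (real (Suc n) + 1) * \<epsilon>" by (simp add: algebra_simps)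
    show ?case
    proof (cases "S \<subseteq> C")
      case True
      then show ?thesis using H C step \<epsilon> by (intro exI[of _ H] exI[of _ C]) auto
    next
      case False
      then obtain s where s: "s \<in> S" "s \<notin> C" by blast
      obtain H' C' where H': "is_subgroup H'" "finite_index H'" "periodic H' C'"
        and C': "s \<in> C'" "m (C' - S) \<le> \<epsilon>" "t - \<epsilon> \<le> m C' + m H'" using local[OF s(1)] by blast
      define L where "L = H \<inter> H'"
      have L: "is_subgroup L" "finite_index L"
        unfolding L_def using H H' subgroup_Int finite_index_Int by auto
      have per: "periodic L C" "periodic L C'"
        using periodic_mono[OF H(3)] periodic_mono[OF H'(3)] by (auto simp: L_def)
      have "\<delta> / 2 \<le> m H" using mH[OF C(1,2)] Suc.prems by simp
      moreover have "\<delta> / 2 \<le> m H'" using mH[OF _ C'(3), of 0] C'(2) by simp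
      ultimately have "(\<delta> / 2) * (\<delta> / 2) \<le> m H * m H'" by (rule mult_mono) (use \<delta> m_nonneg in auto)
      then have "\<kappa> \<le> m L"
        using m_subgroup_Int[OF H(1) H'(1) H(2) H'(2)] by (simp add: \<kappa>_def L_def power2_eq_square)
      moreover have "m L \<le> m (C' - C)"
        using periodic_nonempty[OF L(1) periodic_Diff[OF L(1) per(2,1)], of s] C'(1) s(2) by simp
      moreover have mU: "m (C \<union> C') = m C + m (C' - C)"
        using m_disjoint[of C "C' - C"] by (simp add: Un_Diff_cancel)
      ultimately have inc: "real (Suc n) * \<kappa> \<le> m (C \<union> C')"
        using C(3) False by (auto simp: algebra_simps)
      show ?thesis
      \<comment> \<open>The union lemma requires points in both differences; if \<open>C\<close>
        lies in \<open>C'\<close>, the pair \<open>H'\<close>, \<open>C'\<close> itself continues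
        the chain.\<close>
      proof (cases "C \<subseteq> C'")
        case True
        have "0 \<le> (real n + 1) * \<epsilon>" using \<epsilon> by simp
        then have "m (C' - S) \<le> (real (Suc n) + 1) * \<epsilon>" using C'(2) step by linarith
        then show ?thesis using H' C'(3) inc True by (intro exI[of _ H'] exI[of _ C']) (auto simp: Un_absorb1)
      next
        case False
        then obtain y where y: "y \<in> C" "y \<notin> C'" by blast
        have mU': "m (C \<union> C') = m C' + m (C - C')"
          using m_disjoint[of C' "C - C'"] by (simp add: Un_Diff_cancel Un_commute)
        have "m (C \<union> C' - S) \<le> m (C - S) + m (C' - S)"
          using m_Un_le[of "C - S" "C' - S"] by (simp add: Un_Diff)
        then have "m (C \<union> C' - S) \<le> (real (Suc n) + 1) * \<epsilon>" using C(1) C'(2) step by linarith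
        moreover have "t - \<epsilon> \<le> m (C \<union> C') + m L"
          using union_lemma[OF H(1) H'(1) H(2) H'(2) H(3) H'(3) C'(1) s(2) y] mU mU' C(2) C'(3)
          by (auto simp: L_def)
        ultimately show ?thesis
          using L periodic_Un[OF per] inc by (intro exI[of _ L] exI[of _ "C \<union> C'"]) auto
      qed
    qed
  qed
  obtain H C where H: "is_subgroup H" "finite_index H" "periodic H C"
    and C: "m (C - S) \<le> (real n0 + 1) * \<epsilon>" "t - \<epsilon> \<le> m C + m H" "S \<subseteq> C \<or> real n0 * \<kappa> \<le> m C"
    using chain[of n0] by auto
  have SC: "S \<subseteq> C" using C(3) n0 m_le_1[of C] by auto
  have "\<delta> / 2 \<le> m H" using mH[OF C(1,2)] by simp
  obtain k :: nat where k: "real k * m H = 1" "k > 0" "m H > 0" by (rule index_pos[OF H(1,2)])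
  obtain j :: nat where j: "m C = real j * m H" by (rule periodic_multiple[OF H])
  have mH_eq: "m H = 1 / real k" using k by (simp add: field_simps)
  have "real k * (\<delta> / 2) \<le> real k * m H" by (rule mult_left_mono) (use \<open>\<delta> / 2 \<le> m H\<close> in auto)
  then have "real k * \<delta> \<le> real N * \<delta>" using k(1) N by simp
  then have kN: "k \<le> N" using \<delta> by simp
  have "real j / real k \<le> 1" using m_le_1[of C] j mH_eq by simp
  then have jk: "j \<le> k" using k(2) by (simp add: field_simps)
  have mC: "m C = real j / real k" and mCH: "m C + m H = real (j + 1) / real k"
    using j mH_eq by (auto simp: add_divide_distrib)
  have inV: "m C \<in> V" "m C + m H \<in> V"
  proof -
    have "real i / real k \<in> V" if "i \<le> N + 1" for i
      unfolding V_def using that kN by (intro image_eqI[of _ _ "(i, k)"]) auto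
    from this[of j] this[of "j + 1"] show "m C \<in> V" "m C + m H \<in> V"
      unfolding mCH unfolding mC using jk kN by auto
  qed
  have "m S \<le> m C" by (rule m_mono[OF SC])
  moreover have "m C = m S + m (C - S)" using m_split[of C S] SC by (simp add: Int_absorb1)
  \<comment> \<open>Now \<open>m C\<close> is closer to \<open>m S\<close> than any other value in
    \<open>V\<close>, and \<open>m C + m H\<close> cannot fall short of \<open>t\<close> by as
    little as \<epsilon>; both errors vanish.\<close>
  moreover have small': "(real n0 + 2) * \<epsilon> < e1" "(real n0 + 2) * \<epsilon> < e2" using \<epsilon>n0 e1(1) e2(1) by auto
  moreover have "0 \<le> real n0 * \<epsilon>" using \<epsilon> by simp
  ultimately have "dist (m S) (m C) < e1" "\<epsilon> < e2"
    using C(1) \<epsilon> by (auto simp: dist_real_def algebra_simps)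
  then have 1: "m C = m S" using e1(2)[OF inV(1)] by force
  have 2: "t \<le> m C + m H"
  proof (rule ccontr)
    assume "\<not> ?thesis"
    then show False using e2(2)[OF inV(2)] C(2) \<open>\<epsilon> < e2\<close> by (auto simp: dist_real_def)
  qed
  show ?thesis by (rule that[OF H]) (use SC 1 2 in \<open>auto simp: S_def t_def\<close>)
qed

end

section \<open>Extreme invariant means are ergodic\<close>

lemma Im_Re_unit: "z \<in> complex_of_real ` {0..1} \<longleftrightarrow> Im z = 0 \<and> 0 \<le> Re z \<and> Re z \<le> 1"
  by (auto simp: complex_eq_iff intro!: image_eqI[of _ _ "Re z"])

lemma Im_Re_nonneg: "z \<in> complex_of_real ` {0..} \<longleftrightarrow> Im z = 0 \<and> 0 \<le> Re z"
  by (auto simp: complex_eq_iff intro!: image_eqI[of _ _ "Re z"])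

text \<open>Normalization is left out so that the two parts into which an extreme mean is split also
  qualify.\<close>

definition positive :: "(('a::discrete_topology \<Rightarrow>\<^sub>C complex) \<Rightarrow>\<^sub>L complex) \<Rightarrow> bool" where
  "positive \<mu> \<longleftrightarrow> (\<forall>c f. blinfun_apply \<mu> (bscale c f) = c * blinfun_apply \<mu> f) \<and>
    (\<forall>f. (\<forall>x. Im (apply_bcontfun f x) = 0 \<and> 0 \<le> Re (apply_bcontfun f x)) \<longrightarrow>
      Im (blinfun_apply \<mu> f) = 0 \<and> 0 \<le> Re (blinfun_apply \<mu> f))"

lemma positive_scale: "positive \<mu> \<Longrightarrow> blinfun_apply \<mu> (bscale c f) = c * blinfun_apply \<mu> f"
  by (simp add: positive_def)

lemma positive_nonneg:
  assumes "positive \<mu>" "\<And>x. Im (apply_bcontfun f x) = 0" "\<And>x. 0 \<le> Re (apply_bcontfun f x)"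
  shows "Im (blinfun_apply \<mu> f) = 0" "0 \<le> Re (blinfun_apply \<mu> f)"
  using assms by (auto simp: positive_def)

lemma is_mean_iff_positive: "is_mean \<mu> \<longleftrightarrow> positive \<mu> \<and> blinfun_apply \<mu> (char_fun UNIV) = 1"
proof
  assume m: "is_mean \<mu>"
  have "Im (blinfun_apply \<mu> f) = 0 \<and> 0 \<le> Re (blinfun_apply \<mu> f)"
    if f: "\<forall>x. Im (apply_bcontfun f x) = 0 \<and> 0 \<le> Re (apply_bcontfun f x)" for f
  proof -
    \<comment> \<open>Scaling brings the values of \<open>f\<close> into the unit interval; the
      added 1 covers \<open>f = 0\<close>.\<close>
    define r where "r = 1 / (norm f + 1)"
    have pos: "norm f + 1 > 0" by (simp add: add_nonneg_pos)
    have r: "r > 0" using pos by (simp add: r_def)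
    have "apply_bcontfun (bscale r f) x \<in> complex_of_real ` {0..1}" for x
    proof -
      have "Re (apply_bcontfun f x) \<le> norm f"
        using complex_Re_le_cmod norm_bounded order_trans by blast
      then have "r * Re (apply_bcontfun f x) \<le> 1" using pos by (simp add: r_def field_simps)
      then show ?thesis using f r unfolding Im_Re_unit by simp
    qed
    then have "blinfun_apply \<mu> (bscale r f) \<in> complex_of_real ` {0..}"
      using m unfolding is_mean_def by blast
    then have "of_real r * blinfun_apply \<mu> f \<in> complex_of_real ` {0..}"
      using m unfolding is_mean_def by metis
    then show ?thesis using r unfolding Im_Re_nonneg by (simp add: zero_le_mult_iff)
  qed
  then show "positive \<mu> \<and> blinfun_apply \<mu> (char_fun UNIV) = 1"
    using m unfolding positive_def is_mean_def by blast
next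
  assume p: "positive \<mu> \<and> blinfun_apply \<mu> (char_fun UNIV) = 1"
  then show "is_mean \<mu>" unfolding is_mean_def positive_def Im_Re_unit Im_Re_nonneg by blast
qed

section \<open>Averaging a mean over translates of a set\<close>

definition restrict_fun :: "'a::discrete_topology set \<Rightarrow> ('a \<Rightarrow>\<^sub>C complex) \<Rightarrow> ('a \<Rightarrow>\<^sub>C complex)" where
  "restrict_fun C f = Bcontfun (\<lambda>x. if x \<in> C then apply_bcontfun f x else 0)"

lemma apply_restrict_fun [simp]:
  "apply_bcontfun (restrict_fun C f) x = (if x \<in> C then apply_bcontfun f x else 0)"
proof -
  have "(\<lambda>x. if x \<in> C then apply_bcontfun f x else 0) \<in> bcontfun"
    by (rule bcontfun_normI[where b = "norm f"]) (auto simp: norm_bounded)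
  then show ?thesis by (simp add: restrict_fun_def Bcontfun_inverse)
qed

lemma norm_restrict_fun: "norm (restrict_fun C f) \<le> norm f"
  by (rule norm_bound) (simp add: norm_bounded)

definition correlation :: "(('a::{ab_group_add, discrete_topology} \<Rightarrow>\<^sub>C complex) \<Rightarrow>\<^sub>L complex) \<Rightarrow>
    'a set \<Rightarrow> ('a \<Rightarrow>\<^sub>C complex) \<Rightarrow> ('a \<Rightarrow>\<^sub>C complex)" where
  "correlation \<mu> B f = Bcontfun (\<lambda>e. blinfun_apply \<mu> (restrict_fun (shift e B) f))"

lemma norm_apply_restrict:
  "norm (blinfun_apply \<mu> (restrict_fun C f)) \<le> norm \<mu> * norm f"
  by (rule order_trans[OF norm_blinfun mult_left_mono[OF norm_restrict_fun norm_ge_zero]])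

lemma apply_correlation [simp]:
  "apply_bcontfun (correlation \<mu> B f) e = blinfun_apply \<mu> (restrict_fun (shift e B) f)"
proof -
  have "(\<lambda>e. blinfun_apply \<mu> (restrict_fun (shift e B) f)) \<in> bcontfun"
    by (rule bcontfun_normI[where b = "norm \<mu> * norm f"]) (auto intro: norm_apply_restrict)
  then show ?thesis by (simp add: correlation_def Bcontfun_inverse)
qed

definition averaged :: "(('a::{ab_group_add, discrete_topology} \<Rightarrow>\<^sub>C complex) \<Rightarrow>\<^sub>L complex) \<Rightarrow>
    'a set \<Rightarrow> (('a \<Rightarrow>\<^sub>C complex) \<Rightarrow>\<^sub>L complex)" where
  "averaged \<mu> B = Blinfun (\<lambda>f. blinfun_apply \<mu> (correlation \<mu> B f))"

lemma apply_averaged [simp]: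
  "blinfun_apply (averaged \<mu> B) f = blinfun_apply \<mu> (correlation \<mu> B f)"
proof -
  have "bounded_linear (\<lambda>f. blinfun_apply \<mu> (correlation \<mu> B f))"
  proof (rule bounded_linear_intro)
    fix f g :: "'a \<Rightarrow>\<^sub>C complex" and r :: real
    have "restrict_fun C (f + g) = restrict_fun C f + restrict_fun C g" for C
      by (rule bcontfun_eqI) (simp add: plus_bcontfun.rep_eq)
    then have "correlation \<mu> B (f + g) = correlation \<mu> B f + correlation \<mu> B g"
      by (intro bcontfun_eqI) (simp add: plus_bcontfun.rep_eq blinfun.add_right)
    then show "blinfun_apply \<mu> (correlation \<mu> B (f + g)) =
        blinfun_apply \<mu> (correlation \<mu> B f) + blinfun_apply \<mu> (correlation \<mu> B g)"
      by (simp add: blinfun.add_right)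
    have "restrict_fun C (r *\<^sub>R f) = r *\<^sub>R restrict_fun C f" for C
      by (rule bcontfun_eqI) (simp add: scaleR_bcontfun.rep_eq)
    then have "correlation \<mu> B (r *\<^sub>R f) = r *\<^sub>R correlation \<mu> B f"
      by (intro bcontfun_eqI) (simp add: scaleR_bcontfun.rep_eq blinfun.scaleR_right)
    then show "blinfun_apply \<mu> (correlation \<mu> B (r *\<^sub>R f)) = r *\<^sub>R blinfun_apply \<mu> (correlation \<mu> B f)"
      by (simp add: blinfun.scaleR_right)
    have "norm (correlation \<mu> B f) \<le> norm \<mu> * norm f"
      by (rule norm_bound) (simp add: norm_apply_restrict)
    then have "norm \<mu> * norm (correlation \<mu> B f) \<le> norm \<mu> * (norm \<mu> * norm f)"
      by (rule mult_left_mono) simp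
    then show "norm (blinfun_apply \<mu> (correlation \<mu> B f)) \<le> norm f * (norm \<mu> * norm \<mu>)"
      using norm_blinfun[of \<mu> "correlation \<mu> B f"] by (simp add: mult_ac)
  qed
  then show ?thesis by (simp add: averaged_def bounded_linear_Blinfun_apply)
qed

lemma translation_invariant:
  "\<mu> \<in> invariant_means \<Longrightarrow> blinfun_apply \<mu> (translate g f) = blinfun_apply \<mu> f"
  by (simp add: invariant_means_def)

lemma invariant_means_positive: "\<mu> \<in> invariant_means \<Longrightarrow> positive \<mu>"
  and invariant_means_UNIV: "\<mu> \<in> invariant_means \<Longrightarrow> blinfun_apply \<mu> (char_fun UNIV) = 1"
  by (auto simp: invariant_means_def is_mean_iff_positive)

lemma normalized_invariant_mean:
  assumes "positive \<mu>" "\<And>g f. blinfun_apply \<mu> (translate g f) = blinfun_apply \<mu> f"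
    and "blinfun_apply \<mu> (char_fun UNIV) = of_real b" "b > 0"
  shows "(1 / b) *\<^sub>R \<mu> \<in> invariant_means"
  using assms unfolding invariant_means_def is_mean_iff_positive positive_def
  by (auto simp: blinfun.scaleR_left scaleR_conv_of_real)

lemma apply_char_fun_mean:
  assumes "positive \<mu>"
  shows "blinfun_apply \<mu> (char_fun C) = of_real (mean_of \<mu> C)" "0 \<le> mean_of \<mu> C"
  using positive_nonneg[OF assms, of "char_fun C"] by (auto simp: mean_of_def complex_eq_iff)

lemma invariant_mean_mean_of:
  assumes "\<mu> \<in> invariant_means"
  shows "invariant_mean (mean_of \<mu>)"
proof
  show "mean_of \<mu> UNIV = 1" using invariant_means_UNIV[OF assms] by (simp add: mean_of_def)
  fix X Y :: "'a set" and g :: 'a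
  show "0 \<le> mean_of \<mu> X" by (rule apply_char_fun_mean(2)[OF invariant_means_positive[OF assms]])
  show "mean_of \<mu> (X \<union> Y) = mean_of \<mu> X + mean_of \<mu> Y" if "X \<inter> Y = {}"
  proof -
    have "char_fun (X \<union> Y) = char_fun X + (char_fun Y :: 'a \<Rightarrow>\<^sub>C complex)"
      by (rule bcontfun_eqI) (use that in \<open>auto simp: plus_bcontfun.rep_eq\<close>)
    then show ?thesis by (simp add: mean_of_def blinfun.add_right)
  qed
  have "char_fun (shift g X) = translate g (char_fun X)" by (rule bcontfun_eqI) simp
  then show "mean_of \<mu> (shift g X) = mean_of \<mu> X"
    using translation_invariant[OF assms] by (simp add: mean_of_def)
qed

lemma restrict_char_fun: "restrict_fun C (char_fun A) = char_fun (A \<inter> C)"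
  by (rule bcontfun_eqI) auto

text \<open>
  Both \<open>averaged \<mu> B\<close> and \<open>\<mu> - averaged \<mu> B\<close> are positive and invariant, so extremality of
  \<open>\<mu>\<close> forces them to be multiples of \<open>\<mu>\<close>.
\<close>

lemma averaged_extreme:
  assumes ext: "\<mu> extreme_point_of invariant_means"
  shows "blinfun_apply \<mu> (correlation \<mu> B (char_fun A)) = of_real (mean_of \<mu> A * mean_of \<mu> B)"
proof -
  have \<mu>: "\<mu> \<in> invariant_means" using ext by (simp add: extreme_point_of_def)
  note pos = invariant_means_positive[OF \<mu>]
  interpret invariant_mean "mean_of \<mu>" by (rule invariant_mean_mean_of[OF \<mu>])
  define b where "b = mean_of \<mu> B"
  have const: "blinfun_apply \<mu> f = c" if "\<And>x. apply_bcontfun f x = c" for f c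
  proof -
    have "f = bscale c (char_fun UNIV)" by (rule bcontfun_eqI) (simp add: that)
    then show ?thesis using positive_scale[OF pos] invariant_means_UNIV[OF \<mu>] by simp
  qed
  have corr: "apply_bcontfun (correlation \<mu> B (char_fun A)) e = of_real (mean_of \<mu> (A \<inter> shift e B))" for e A
    using apply_char_fun_mean(1)[OF pos] by (simp add: restrict_char_fun)
  \<comment> \<open>Normalizing the two parts divides by \<open>b\<close> and \<open>1 - b\<close>;
    for the extreme values of \<open>b\<close> the correlation is constant.\<close>
  consider "b \<le> 0" | "1 \<le> b" | "0 < b" "b < 1" by linarith
  then show ?thesis
  proof cases
    case 1
    then have "b = 0" using m_nonneg[of B] by (simp add: b_def)
    moreover have "mean_of \<mu> (A \<inter> shift e B) = 0" for e
      using m_mono[of "A \<inter> shift e B" "shift e B"] m_nonneg[of "A \<inter> shift e B"] calculation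
      by (simp add: b_def)
    ultimately show ?thesis using const[of _ 0] corr by (simp add: b_def)
  next
    case 2
    then have "b = 1" using m_le_1[of B] by (simp add: b_def)
    moreover have "mean_of \<mu> (A \<inter> shift e B) = mean_of \<mu> A" for e
      using m_modular[of A "shift e B"] m_le_1[of "A \<union> shift e B"] m_mono[of "A \<inter> shift e B" A] calculation
      by (simp add: b_def)
    ultimately show ?thesis using const[of _ "of_real (mean_of \<mu> A)"] corr by (simp add: b_def)
  next
    case 3
    let ?\<rho> = "averaged \<mu> B"
    have scale: "correlation \<mu> B (bscale c f) = bscale c (correlation \<mu> B f)" for c f
    proof -
      have "restrict_fun C (bscale c f) = bscale c (restrict_fun C f)" for C :: "'a set"
        by (rule bcontfun_eqI) simp
      then show ?thesis by (intro bcontfun_eqI) (simp add: positive_scale[OF pos])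
    qed
    have \<rho>_scale: "blinfun_apply ?\<rho> (bscale c f) = c * blinfun_apply ?\<rho> f" for c f
      by (simp add: scale positive_scale[OF pos])
    have \<rho>_pos: "positive ?\<rho>"
      unfolding positive_def
    proof (intro conjI allI impI)
      fix f :: "'a \<Rightarrow>\<^sub>C complex"
      assume f: "\<forall>x. Im (apply_bcontfun f x) = 0 \<and> 0 \<le> Re (apply_bcontfun f x)"
      then have "Im (blinfun_apply \<mu> (restrict_fun C f)) = 0" "0 \<le> Re (blinfun_apply \<mu> (restrict_fun C f))" for C
        using positive_nonneg[OF pos, of "restrict_fun C f"] by auto
      then show "Im (blinfun_apply ?\<rho> f) = 0" "0 \<le> Re (blinfun_apply ?\<rho> f)"
        using positive_nonneg[OF pos, of "correlation \<mu> B f"] by auto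
    qed (rule \<rho>_scale)
    have \<rho>_inv: "blinfun_apply ?\<rho> (translate g f) = blinfun_apply ?\<rho> f" for g f
    proof -
      have "restrict_fun (shift e B) (translate g f) = translate g (restrict_fun (shift (e - g) B) f)" for e
        by (rule bcontfun_eqI) (simp add: algebra_simps)
      then have "correlation \<mu> B (translate g f) = translate g (correlation \<mu> B f)"
        by (intro bcontfun_eqI) (simp add: translation_invariant[OF \<mu>])
      then show ?thesis by (simp add: translation_invariant[OF \<mu>])
    qed
    have \<rho>_UNIV: "blinfun_apply ?\<rho> (char_fun UNIV) = of_real b"
      using const[of "correlation \<mu> B (char_fun UNIV)" "of_real b"] corr[of UNIV] by (simp add: b_def)
    have \<sigma>_pos: "positive (\<mu> - ?\<rho>)"
      unfolding positive_def
    proof (intro conjI allI impI)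
      fix f :: "'a \<Rightarrow>\<^sub>C complex"
      assume f: "\<forall>x. Im (apply_bcontfun f x) = 0 \<and> 0 \<le> Re (apply_bcontfun f x)"
      \<comment> \<open>Its value at \<open>e\<close> is the mean of \<open>f\<close> cut off to the
        complement of \<open>e + B\<close>, so it is nonnegative, and its mean is the value of
        \<open>\<mu> - ?\<rho>\<close> at \<open>f\<close>.\<close>
      define h where "h = bscale (blinfun_apply \<mu> f) (char_fun UNIV) - correlation \<mu> B f"
      have h: "apply_bcontfun h e = blinfun_apply \<mu> (restrict_fun (- shift e B) f)" for e
      proof -
        have "f - restrict_fun (shift e B) f = restrict_fun (- shift e B) f"
          by (rule bcontfun_eqI) (simp add: minus_bcontfun.rep_eq)
        then show ?thesis by (simp add: h_def minus_bcontfun.rep_eq blinfun.diff_right[symmetric])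
      qed
      have "Im (blinfun_apply \<mu> (restrict_fun C f)) = 0" "0 \<le> Re (blinfun_apply \<mu> (restrict_fun C f))" for C
        using f positive_nonneg[OF pos, of "restrict_fun C f"] by auto
      then have "Im (blinfun_apply \<mu> h) = 0" "0 \<le> Re (blinfun_apply \<mu> h)"
        using positive_nonneg[OF pos, of h] by (auto simp: h)
      moreover have "blinfun_apply \<mu> h = blinfun_apply (\<mu> - ?\<rho>) f"
        by (simp add: h_def blinfun.diff_right blinfun.diff_left positive_scale[OF pos] invariant_means_UNIV[OF \<mu>])
      ultimately show "Im (blinfun_apply (\<mu> - ?\<rho>) f) = 0" "0 \<le> Re (blinfun_apply (\<mu> - ?\<rho>) f)" by auto
    next
      fix c and f :: "'a \<Rightarrow>\<^sub>C complex"
      show "blinfun_apply (\<mu> - ?\<rho>) (bscale c f) = c * blinfun_apply (\<mu> - ?\<rho>) f"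
        using \<rho>_scale by (simp add: blinfun.diff_left positive_scale[OF pos] algebra_simps)
    qed
    define m1 where "m1 = (1 / b) *\<^sub>R ?\<rho>"
    define m2 where "m2 = (1 / (1 - b)) *\<^sub>R (\<mu> - ?\<rho>)"
    have m1: "m1 \<in> invariant_means"
      unfolding m1_def by (rule normalized_invariant_mean[OF \<rho>_pos \<rho>_inv \<rho>_UNIV 3(1)])
    have m2: "m2 \<in> invariant_means"
      unfolding m2_def
    proof (rule normalized_invariant_mean[OF \<sigma>_pos])
      show "blinfun_apply (\<mu> - ?\<rho>) (translate g f) = blinfun_apply (\<mu> - ?\<rho>) f" for g f
        using \<rho>_inv translation_invariant[OF \<mu>] by (simp add: blinfun.diff_left)
      show "blinfun_apply (\<mu> - ?\<rho>) (char_fun UNIV) = of_real (1 - b)"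
        using \<rho>_UNIV invariant_means_UNIV[OF \<mu>] by (simp add: blinfun.diff_left)
    qed (use 3 in simp)
    have "b *\<^sub>R m1 = ?\<rho>" using 3 by (simp add: m1_def)
    moreover have "(1 - b) *\<^sub>R m2 = \<mu> - ?\<rho>" using 3 by (simp add: m2_def)
    ultimately have comb: "\<mu> = (1 - b) *\<^sub>R m2 + b *\<^sub>R m1" by simp
    have "m1 = m2"
    proof (rule ccontr)
      assume "m1 \<noteq> m2"
      then have "\<mu> \<in> open_segment m2 m1" unfolding in_segment using comb 3 by blast
      then show False using ext m1 m2 by (auto simp: extreme_point_of_def)
    qed
    then have "\<mu> = m1" using comb by (simp add: scaleR_left_diff_distrib)
    then have "?\<rho> = b *\<^sub>R \<mu>" using \<open>b *\<^sub>R m1 = ?\<rho>\<close> by simp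
    then have "blinfun_apply ?\<rho> (char_fun A) = b *\<^sub>R blinfun_apply \<mu> (char_fun A)"
      by (simp only: blinfun.scaleR_left)
    then show ?thesis
      using apply_char_fun_mean(1)[OF pos] by (simp add: b_def scaleR_conv_of_real)
  qed
qed

lemma ergodic_mean_mean_of:
  assumes ext: "\<mu> extreme_point_of invariant_means"
  shows "ergodic_mean (mean_of \<mu>)"
proof -
  have \<mu>: "\<mu> \<in> invariant_means" using ext by (simp add: extreme_point_of_def)
  note pos = invariant_means_positive[OF \<mu>]
  interpret invariant_mean "mean_of \<mu>" by (rule invariant_mean_mean_of[OF \<mu>])
  show ?thesis
  proof
    fix A Z B :: "'a set" and c d :: real
    assume disj: "A \<inter> Z = {}"
      and c: "\<And>e. e \<in> A \<Longrightarrow> c \<le> mean_of \<mu> (A \<inter> shift e B)"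
      and d: "\<And>e. e \<in> Z \<Longrightarrow> d \<le> mean_of \<mu> (A \<inter> shift e B)"
    \<comment> \<open>The correlation minus the step function with values \<open>c\<close> on
      \<open>A\<close> and \<open>d\<close> on \<open>Z\<close>. Disjointness makes it pointwise
      nonnegative, and its mean is the difference of the two sides.\<close>
    define h where "h = correlation \<mu> B (char_fun A) -
      (bscale (of_real c) (char_fun A) + bscale (of_real d) (char_fun Z))"
    have h: "apply_bcontfun h e = of_real (mean_of \<mu> (A \<inter> shift e B) -
        ((if e \<in> A then c else 0) + (if e \<in> Z then d else 0)))" for e
      using apply_char_fun_mean(1)[OF pos]
      by (simp add: h_def minus_bcontfun.rep_eq plus_bcontfun.rep_eq restrict_char_fun)
    have "0 \<le> Re (blinfun_apply \<mu> h)"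
      by (rule positive_nonneg(2)[OF pos]) (use c d disj m_nonneg in \<open>auto simp: h\<close>)
    moreover have "blinfun_apply \<mu> h = of_real (mean_of \<mu> A * mean_of \<mu> B - (c * mean_of \<mu> A + d * mean_of \<mu> Z))"
      unfolding h_def
      by (simp add: blinfun.diff_right blinfun.add_right positive_scale[OF pos]
          averaged_extreme[OF ext] apply_char_fun_mean(1)[OF pos])
    ultimately show "c * mean_of \<mu> A + d * mean_of \<mu> Z \<le> mean_of \<mu> A * mean_of \<mu> B" by simp
  qed
qed

section \<open>Stabilizers and uniqueness\<close>

lemma plus_singleton: "X + {g} = shift g X" "{g} + X = shift g X"
proof -
  show "X + {g} = shift g X"
    by (auto simp: set_plus_def algebra_simps intro: bexI[of _ "x - g" for x])
  then show "{g} + X = shift g X" by (simp add: add.commute)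
qed

lemma finite_index_subgroup_iff: "finite_index_subgroup K \<longleftrightarrow> is_subgroup K \<and> finite_index K"
proof -
  have "0 \<in> K \<and> (\<forall>x\<in>K. \<forall>y\<in>K. x + y \<in> K) \<and> (\<forall>x\<in>K. - x \<in> K) \<longleftrightarrow> is_subgroup K"
    (is "?l \<longleftrightarrow> _")
  proof
    assume l: ?l
    then have "x + - y \<in> K" if "x \<in> K" "y \<in> K" for x y using that by blast
    with l show "is_subgroup K" by (simp add: is_subgroup_def)
  next
    assume "is_subgroup K"
    then show ?l using subgroup_0 subgroup_add subgroup_minus by blast
  qed
  then show ?thesis unfolding finite_index_subgroup_def finite_index_def plus_singleton by blast
qed

lemma in_stabilizer: "g \<in> stabilizer X \<longleftrightarrow> shift g X = X"
  by (simp add: stabilizer_def plus_singleton)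

lemma subgroup_stabilizer: "is_subgroup (stabilizer X)"
proof -
  have "shift (x - y) X = X" if "shift x X = X" "shift y X = X" for x y
    using that shift_shift[of "- y" x X] shift_shift[of "- y" y X] by simp
  then show ?thesis by (simp add: is_subgroup_def in_stabilizer)
qed

lemma periodic_stabilizer: "periodic (stabilizer X) X"
proof -
  have "x + h \<in> X" if "x \<in> X" "shift h X = X" for x h
    using in_shift[of "x + h" h X] that by simp
  then show ?thesis by (simp add: periodic_def in_stabilizer)
qed

lemma subset_stabilizer:
  assumes "is_subgroup H" "periodic H X" shows "H \<subseteq> stabilizer X"
proof
  fix h assume h: "h \<in> H"
  have "x - h \<in> X \<longleftrightarrow> x \<in> X" for x
    using periodicD[OF assms(2) _ h, of "x - h"]
      periodicD[OF assms(2) _ subgroup_minus[OF assms(1) h], of x] by auto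
  then show "h \<in> stabilizer X" unfolding in_stabilizer shift_def by simp
qed

lemma subgroup_plus_self: "is_subgroup K \<Longrightarrow> K + K = K"
  using subset_plus_subgroup[of K K] plus_subset_periodic[of K K K] subgroup_add[of K]
  by (auto simp: periodic_def)

context invariant_mean
begin

text \<open>The set \<open>X - Y\<close> misses \<open>S\<close>, hence is null; being periodic
  under \<open>H \<inter> K\<close>, it would contain a coset of positive mean if it were
  nonempty.\<close>

lemma periodic_subset:
  assumes H: "is_subgroup H" "finite_index H" "periodic H X"
    and K: "is_subgroup K" "finite_index K" "periodic K Y"
    and S: "S \<subseteq> X" "S \<subseteq> Y" "m X \<le> m S"
  shows "X \<subseteq> Y"
proof (rule ccontr)
  assume "\<not> X \<subseteq> Y"
  then obtain x where x: "x \<in> X - Y" by blast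
  let ?L = "H \<inter> K"
  have L: "is_subgroup ?L" "finite_index ?L" using H K subgroup_Int finite_index_Int by auto
  have "periodic ?L (X - Y)"
    by (rule periodic_Diff[OF L(1) periodic_mono[OF H(3)] periodic_mono[OF K(3)]]) auto
  then have "m ?L \<le> m (X - Y)" using periodic_nonempty[OF L(1)] x by blast
  moreover obtain k where "m ?L > 0" by (rule index_pos[OF L])
  moreover have "m S \<le> m (X \<inter> Y)" by (rule m_mono) (use S in blast)
  ultimately show False using m_split[of X Y] S(3) by simp
qed

end

context ergodic_mean
begin

text \<open>A first use of \<open>kneser_component\<close> produces \<open>C\<close> and its
  stabilizer \<open>K\<close>. A second, for \<open>A + K\<close> and \<open>B + K\<close> with the
  same sumset \<open>C\<close>, bounds the sum of their means above by \<open>m C + m K\<close>; the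
  reverse bound is integrality.\<close>

lemma kneser_stabilizer:
  assumes ne: "A \<noteq> {}" "B \<noteq> {}" and small: "m (A + B) < m A + m B"
  obtains K where "is_subgroup K" "finite_index K" "K = stabilizer (A + B + K)"
    "m (A + B) = m (A + B + K)" "m (A + B + K) = m (A + K) + m (B + K) - m K"
proof -
  obtain H C where H: "is_subgroup H" "finite_index H" "periodic H C"
    and C: "A + B \<subseteq> C" "m C = m (A + B)" "m A + m B \<le> m C + m H"
    by (rule kneser_component[OF ne small])
  define K where "K = stabilizer C"
  have HK: "H \<subseteq> K" unfolding K_def by (rule subset_stabilizer[OF H(1,3)])
  have K: "is_subgroup K" "finite_index K" "periodic K C"
    unfolding K_def
    using subgroup_stabilizer periodic_stabilizer finite_index_mono[OF H(2) HK[unfolded K_def] H(1)]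
    by auto
  have sub: "A + B \<subseteq> A + B + K" by (rule subset_plus_subgroup[OF K(1)])
  have CK: "A + B + K = C"
    by (rule periodic_eq[OF K(1,2) periodic_plus[OF K(1)] K(3) plus_subset_periodic[OF K(3) C(1)]])
      (use C(2) m_mono[OF sub] in simp)
  have "A + K + (B + K) = A + B + (K + K)" by (simp only: add_ac)
  then have sum: "A + K + (B + K) = C" using CK subgroup_plus_self[OF K(1)] by simp
  have le: "m A \<le> m (A + K)" "m B \<le> m (B + K)"
    using m_mono subset_plus_subgroup[OF K(1)] by auto
  have ne': "A + K \<noteq> {}" "B + K \<noteq> {}" using ne subset_plus_subgroup[OF K(1)] by (metis subset_empty)+
  have small': "m (A + K + (B + K)) < m (A + K) + m (B + K)" using sum C(2) small le by simp
  obtain H' C' where H': "is_subgroup H'" "finite_index H'" "periodic H' C'"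
    and C': "C \<subseteq> C'" "m C' = m C" "m (A + K) + m (B + K) \<le> m C' + m H'"
    by (rule kneser_component[OF ne' small', unfolded sum])
  have "C' \<subseteq> C" by (rule periodic_subset[OF H' K C'(1) order_refl]) (simp add: C'(2))
  then have "C' = C" using C'(1) by blast
  then have "H' \<subseteq> K" using subset_stabilizer[OF H'(1,3)] by (simp add: K_def)
  then have "m H' \<le> m K" by (rule m_mono)
  then have upper: "m (A + K) + m (B + K) \<le> m C + m K" using C' by simp
  obtain a :: nat where a: "m (A + K) = real a * m K"
    by (rule periodic_multiple[OF K(1,2) periodic_plus[OF K(1)]])
  obtain b :: nat where b: "m (B + K) = real b * m K"
    by (rule periodic_multiple[OF K(1,2) periodic_plus[OF K(1)]])
  obtain c :: nat where c: "m C = real c * m K" by (rule periodic_multiple[OF K])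
  obtain k where k: "m K > 0" by (rule index_pos[OF K(1,2)])
  \<comment> \<open>In units of \<open>m K\<close> all three means are integers, so the strict
    inequality gains a full unit.\<close>
  have "real c * m K < real (a + b) * m K" using small' sum a b c by (simp add: distrib_right)
  then have "c + 1 \<le> a + b" using k by simp
  then have "real (c + 1) * m K \<le> real (a + b) * m K" by (intro mult_right_mono of_nat_mono m_nonneg)
  then have lower: "m C + m K \<le> m (A + K) + m (B + K)" using a b c by (simp add: distrib_right)
  show ?thesis
    by (rule that[OF K(1,2)]) (use CK C(2) upper lower in \<open>auto simp: K_def\<close>)
qed

end

section \<open>Uniqueness of the subgroup\<close>

definition regular_for ::
  "(('a::{ab_group_add, discrete_topology} \<Rightarrow>\<^sub>C complex) \<Rightarrow>\<^sub>L complex) \<Rightarrow> 'a set \<Rightarrow> 'a set \<Rightarrow> bool" where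
  "regular_for \<nu> S K \<longleftrightarrow> \<nu> \<in> invariant_means \<and> finite_index_subgroup K \<and>
    K = stabilizer (S + K) \<and> mean_of \<nu> S = mean_of \<nu> (S + K)"

lemma regular_for_subset:
  assumes "regular_for \<nu> S K" "regular_for \<nu>' S K'"
  shows "S + K \<subseteq> S + K'"
proof -
  interpret invariant_mean "mean_of \<nu>"
    by (rule invariant_mean_mean_of) (use assms(1) in \<open>simp add: regular_for_def\<close>)
  have K: "is_subgroup K" "finite_index K" "is_subgroup K'" "finite_index K'"
    and eq: "mean_of \<nu> S = mean_of \<nu> (S + K)"
    using assms by (auto simp: regular_for_def finite_index_subgroup_iff)
  show ?thesis
    by (rule periodic_subset[OF K(1,2) periodic_plus[OF K(1)] K(3,4) periodic_plus[OF K(3)]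
          subset_plus_subgroup[OF K(1)] subset_plus_subgroup[OF K(3)]])
      (simp add: eq)
qed

text \<open>The means may differ: each inclusion uses only one of them. Once the periodic hulls
  agree, so do their stabilizers.\<close>

lemma regular_for_unique:
  assumes "regular_for \<nu> S K" "regular_for \<nu>' S K'"
  shows "K = K'"
proof -
  have "S + K = S + K'" using regular_for_subset assms by blast
  then show ?thesis using assms unfolding regular_for_def by metis
qed

lemma small_sumset_regular:
  assumes ne: "A \<noteq> {}" "B \<noteq> {}" and small: "small_sumset \<nu> A B"
  obtains K where "regular_for \<nu> (A + B) K"
    "mean_of \<nu> (A + B + K) = mean_of \<nu> (A + K) + mean_of \<nu> (B + K) - mean_of \<nu> K"
proof -
  have ext: "\<nu> extreme_point_of invariant_means" and lt: "mean_of \<nu> (A + B) < mean_of \<nu> A + mean_of \<nu> B"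
    using small by (auto simp: small_sumset_def)
  interpret ergodic_mean "mean_of \<nu>" by (rule ergodic_mean_mean_of[OF ext])
  have "\<nu> \<in> invariant_means" using ext by (simp add: extreme_point_of_def)
  then show ?thesis
    using kneser_stabilizer[OF ne lt] that by (metis finite_index_subgroup_iff regular_for_def)
qed

text \<open>Choosing \<kappa> before \<open>A\<close> and \<open>B\<close> expresses that the
  subgroup depends on \<open>A + B\<close> only and serves all means at once.\<close>

theorem theorem2p4:
  shows "\<exists>\<kappa> :: 'a::{ab_group_add, discrete_topology} set \<Rightarrow> 'a set.
    \<forall>A B. A \<noteq> {} \<and> B \<noteq> {} \<longrightarrow>
      kneser_subgroup A B (\<kappa> (A + B)) \<and>
      ((\<exists>\<nu>. small_sumset \<nu> A B) \<longrightarrow> (\<exists>!K. kneser_subgroup A B K))"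
proof -
  \<comment> \<open>The default \<open>UNIV\<close> has finite index and is the stabilizer of
    \<open>S + UNIV\<close> for nonempty \<open>S\<close>, so the conditions not involving a mean
    hold there too.\<close>
  define \<kappa> :: "'a set \<Rightarrow> 'a set" where
    "\<kappa> S = (if \<exists>K \<nu>. regular_for \<nu> S K then SOME K. \<exists>\<nu>. regular_for \<nu> S K else UNIV)" for S
  have \<kappa>: "\<kappa> S = K" if "regular_for \<nu> S K" for \<nu> S K
  proof -
    have "\<exists>\<nu>. regular_for \<nu> S (\<kappa> S)" using that someI_ex[of "\<lambda>K. \<exists>\<nu>. regular_for \<nu> S K"] by (auto simp: \<kappa>_def)
    then show ?thesis using regular_for_unique that by blast
  qed
  have \<kappa>_group: "finite_index_subgroup (\<kappa> S) \<and> \<kappa> S = stabilizer (S + \<kappa> S)" if "S \<noteq> {}" for S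
  proof (cases "\<exists>K \<nu>. regular_for \<nu> S K")
    case True
    then show ?thesis using \<kappa> unfolding regular_for_def by metis
  next
    case False
    obtain s where "s \<in> S" using \<open>S \<noteq> {}\<close> by blast
    then have "x \<in> S + UNIV" for x using set_plus_intro[of s S "x - s" UNIV] by simp
    then have "S + UNIV = UNIV" by blast
    moreover have "finite_index_subgroup (UNIV :: 'a set)"
      by (simp add: finite_index_subgroup_iff is_subgroup_def finite_index_def shift_def)
    moreover have "stabilizer (UNIV :: 'a set) = UNIV" by (auto simp: in_stabilizer)
    ultimately show ?thesis using False by (simp add: \<kappa>_def)
  qed
  have main: "kneser_subgroup A B (\<kappa> (A + B))" if ne: "A \<noteq> {}" "B \<noteq> {}" for A B
  proof -
    have "A + B \<noteq> {}" using ne by (auto simp: set_plus_def)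
    note group = \<kappa>_group[OF this]
    have "mean_of \<nu> (A + B) = mean_of \<nu> (A + B + \<kappa> (A + B)) \<and> mean_of \<nu> (A + B + \<kappa> (A + B)) =
        mean_of \<nu> (A + \<kappa> (A + B)) + mean_of \<nu> (B + \<kappa> (A + B)) - mean_of \<nu> (\<kappa> (A + B))"
      if small: "small_sumset \<nu> A B" for \<nu>
    proof -
      obtain K where K: "regular_for \<nu> (A + B) K"
        "mean_of \<nu> (A + B + K) = mean_of \<nu> (A + K) + mean_of \<nu> (B + K) - mean_of \<nu> K"
        by (rule small_sumset_regular[OF ne small])
      then show ?thesis unfolding \<kappa>[OF K(1)] by (simp add: regular_for_def)
    qed
    then show ?thesis using group unfolding kneser_subgroup_def by blast
  qed
  have unique: "K = \<kappa> (A + B)" if "kneser_subgroup A B K" "small_sumset \<nu> A B" for \<nu> A B K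
  proof -
    have "\<nu> \<in> invariant_means"
      using that(2) by (simp add: small_sumset_def extreme_point_of_def)
    then have "regular_for \<nu> (A + B) K"
      using that unfolding kneser_subgroup_def regular_for_def by blast
    then show ?thesis using \<kappa> by metis
  qed
  show ?thesis
  proof (intro exI[of _ \<kappa>] allI impI conjI)
    fix A B :: "'a set"
    assume ne: "A \<noteq> {} \<and> B \<noteq> {}"
    then show K: "kneser_subgroup A B (\<kappa> (A + B))" using main by simp
    assume "\<exists>\<nu>. small_sumset \<nu> A B"
    then obtain \<nu> where \<nu>: "small_sumset \<nu> A B" by (rule exE)
    show "\<exists>!K. kneser_subgroup A B K"
      by (rule ex1I[of "kneser_subgroup A B", OF K]) (rule unique[OF _ \<nu>])
  qed
qed

end
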